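(* Assume $\widetilde Q$ carries isothermal boundary-compatible toroidal coordinates $(\zeta,x,y)$. Let $\varrho_\zeta$ be an evolving nowhere-vanishing 2-form on $D$, $\bm u_\zeta$ an evolving vector field on $D$, and $p_\zeta$ an evolving function on $D$. The following are equivalent. (i) $\bm u_\zeta$ is tangent to $\partial D$ for each $\zeta$ and $\partial_\zeta p_\zeta+\mathcal L_{\bm u_\zeta}p_\zeta=0$, $\partial_\zeta\varrho_\zeta+\mathcal L_{\bm u_\zeta}\varrho_\zeta=0$, $\partial_\zeta\pi_\zeta+\mathcal L_{\bm u_\zeta}\pi_\zeta=\frac{dp_\zeta}{n_\zeta}+d\big(\frac{|\pi_\zeta|^2}{n_\zeta}+n_\zeta N_\zeta^2\big)$, where $\pi_\zeta=n_\zeta\,\iota_{\bm u_\zeta+\bm N_\zeta}h_\zeta$, $n_\zeta=\varrho_\zeta/\omega_\zeta$. (ii) $\varrho_\zeta=S^*_\zeta$, $\bm u_\zeta=\frac{\omega_\zeta}{S^*_\zeta}\big(\bm U^*_\zeta/S^*_\zeta\big)^\sharp-\bm N_\zeta$ and $p_\zeta=T^*_\zeta/S^*_\zeta$, where $X^*_\zeta=(\bm U^*_\zeta,S^*_\zeta,T^*_\zeta)$ solves Hamilton's equations on $\mathfrak p^*$ with the time-dependent Hamiltonian $$\mathcal H_\zeta(X^* )=\int_D\Big[\tfrac12\Big|\frac{\bm U^*}{S^*}\Big|^2+\frac{T^*}{S^*}-\tfrac12\Big(\frac{S^*}{\omega_\zeta}\Big)^2N_\zeta^2\Big]\omega_\zeta-\int_D\bm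 U^*\cdot\bm N_\zeta.$$
   Context: $D$ is the closed unit disc with coordinates $(x,y)$. Geometry: $Q\subset\mathbb{R}^3$ a toroidal domain (orientation-preserving diffeomorphism $(\zeta,x,y):Q\to S^1\times D$), $\widetilde Q$ its universal cover with pulled-back Euclidean metric $\widetilde g$, volume form $\Omega$, lifted coordinates $(\zeta,x,y)\in\mathbb{R}\times D$, $I_\zeta(x,y)=(\zeta,x,y)$. On $D$: $h_\zeta=I_\zeta^*\widetilde g$; shift vector $\bm N_\zeta$ with $\iota_{\bm N_\zeta}h_\zeta=I_\zeta^*(\iota_{\partial_\zeta}\widetilde g)$; lapse $N_\zeta$ with $N_\zeta^2=I_\zeta^*(\widetilde g(\partial_\zeta,\partial_\zeta))-h_\zeta(\bm N_\zeta,\bm N_\zeta)$; $\omega_\zeta=I_\zeta^*(\iota_{\partial_\zeta}\Omega)$. $\sharp,\flat,|\cdot|$ are with respect to $h_\zeta$. The coordinates are boundary-compatible if the outward unit normal $\bm n$ to $\partial\widetilde Q$ satisfies $d\zeta(\bm n)=0$, and isothermal if $h_\zeta=f_\zeta(dx^2+dy^2)$ with $f_\zeta$ nowhere vanishing. Lie algebra $\mathfrak p$: triples $X=(\bm U,S,T)$ with $S,T$ smooth functions on $D$ and $\bm U$ a vector field on $D$ with $xU^x+yU^y=0$ on $\partial D$; bracket $[X_1,X_2]=-([\bm U_1,\bm U_2],\mathcal L_{\bm U_1}S_2-\mathcal L_{\bm U_2}S_1,\mathcal L_{\bm U_1}T_2-\mathcal L_{\bm U_2}T_1)$. Its dual $\mathfrak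 p^*$: triples $X^*=(\bm U^*,S^*,T^* )$ with $S^*=\sigma\,dx\wedge dy$, $T^*=\tau\,dx\wedge dy$ (distributional 2-forms) and $\bm U^*=(U_xdx+U_ydy)\otimes(dx\wedge dy)$ a 1-form density with $xU_x+yU_y=0$ on $\partial D$; pairing $\langle X^*,X\rangle=\int_D(U_iU^i+\sigma S+\tau T)\,dx\,dy$. Functional derivative $\delta F/\delta X^*\in\mathfrak p$ is defined by $\frac{d}{d\lambda}|_0F(X^*+\lambda\delta X^* )=\langle\delta X^*,\delta F/\delta X^*\rangle$. Lie–Poisson bracket $\{F,G\}(X^* )=\langle X^*,[\delta F/\delta X^*,\delta G/\delta X^*]\rangle$. Hamilton's equations for $\mathcal H_\zeta$: $\frac{d}{d\zeta}F(X^*_\zeta)=\{F,\mathcal H_\zeta\}(X^*_\zeta)$ for all functionals $F$. Notation: $\bm U^*/S^*$ is the 1-form $\beta$ with $\bm U^*=\beta\otimes S^*$; $T^*/S^*$, $S^*/\omega_\zeta$, $\omega_\zeta/S^*$ denote ratios of 2-forms (functions); $\bm U^*\cdot\bm N_\zeta$ is the 2-form $(U_iN^i_\zeta)dx\wedge dy$. *)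

theory Defs
  imports "HOL-Analysis.Analysis" "HOL-Analysis.Cross3"
begin

text \<open>Conventions.  Every object living on \<open>R \<times> D\<close> (lifted coordinates \<open>(zeta,x,y)\<close>) is a
curried function of three reals; objects on \<open>D\<close> are curried functions of two reals.
Smooth objects on the closed disc are represented by smooth functions on the whole plane
(any smooth extension; only values on \<open>D\<close> matter).  A 2-form on \<open>D\<close> is represented by its
coefficient w.r.t. \<open>dx \<and> dy\<close>, a 1-form / vector field by its two components.
Direction indices: 0 = zeta, 1 = x, 2 = y.\<close>

type_synonym 'a efun = "real \<Rightarrow> real \<Rightarrow> real \<Rightarrow> 'a"
type_synonym sfun = "real \<Rightarrow> real \<Rightarrow> real"

definition pz :: "'a::real_normed_vector efun \<Rightarrow> 'a efun" where
  "pz f z x y = vector_derivative (\<lambda>t. f t x y) (at z)"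
definition px :: "'a::real_normed_vector efun \<Rightarrow> 'a efun" where
  "px f z x y = vector_derivative (\<lambda>t. f z t y) (at x)"
definition py :: "'a::real_normed_vector efun \<Rightarrow> 'a efun" where
  "py f z x y = vector_derivative (\<lambda>t. f z x t) (at y)"

definition pdir :: "nat \<Rightarrow> 'a::real_normed_vector efun \<Rightarrow> 'a efun" where
  "pdir d f = (if d = 0 then pz f else if d = 1 then px f else py f)"

definition pdiff_ok :: "nat \<Rightarrow> 'a::real_normed_vector efun \<Rightarrow> real \<Rightarrow> real \<Rightarrow> real \<Rightarrow> bool" where
  "pdiff_ok d f z x y =
     (if d = 0 then (\<lambda>t. f t x y) differentiable (at z)
      else if d = 1 then (\<lambda>t. f z t y) differentiable (at x)
      else (\<lambda>t. f z x t) differentiable (at y))"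

definition smooth3 :: "'a::real_normed_vector efun \<Rightarrow> bool" where
  "smooth3 f = (\<forall>ds::nat list.
      (\<forall>d<3. \<forall>z x y. pdiff_ok d (foldr pdir ds f) z x y) \<and>
      continuous_on UNIV (\<lambda>(z, x, y). foldr pdir ds f z x y))"

definition smooth2 :: "sfun \<Rightarrow> bool" where
  "smooth2 f = smooth3 (\<lambda>z x y. f x y)"

definition dx2 :: "sfun \<Rightarrow> sfun" where "dx2 f x y = deriv (\<lambda>t. f t y) x"
definition dy2 :: "sfun \<Rightarrow> sfun" where "dy2 f x y = deriv (\<lambda>t. f x t) y"

definition inD :: "real \<Rightarrow> real \<Rightarrow> bool" where "inD x y = (x\<^sup>2 + y\<^sup>2 \<le> 1)"
definition onbd :: "real \<Rightarrow> real \<Rightarrow> bool" where "onbd x y = (x\<^sup>2 + y\<^sup>2 = 1)"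
definition Dset :: "(real \<times> real) set" where "Dset = {q. inD (fst q) (snd q)}"

text \<open>\<open>Phi\<close> is the lift to \<open>R \<times> D\<close> of the inverse of the toroidal coordinates, i.e. the
parametrisation \<open>(zeta,x,y) \<mapsto> point of Q\<close>; \<open>S^1 = R/2\<pi>Z\<close>.
Toroidal domain with orientation preserving coordinates: smooth, \<open>2\<pi>\<close>-periodic in zeta,
injective modulo the period on \<open>R \<times> D\<close>, positive Jacobian determinant.\<close>
definition toroidal :: "(real^3) efun \<Rightarrow> bool" where
  "toroidal Phi \<longleftrightarrow> smooth3 Phi \<and>
     (\<forall>z x y. Phi (z + 2*pi) x y = Phi z x y) \<and>
     (\<forall>z1 x1 y1 z2 x2 y2. inD x1 y1 \<longrightarrow> inD x2 y2 \<longrightarrow> Phi z1 x1 y1 = Phi z2 x2 y2 \<longrightarrow>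
          x1 = x2 \<and> y1 = y2 \<and> (\<exists>k::int. z2 = z1 + 2 * pi * real_of_int k)) \<and>
     (\<forall>z x y. inD x y \<longrightarrow> pz Phi z x y \<bullet> cross3 (px Phi z x y) (py Phi z x y) > 0)"

definition gc :: "(real^3) efun \<Rightarrow> nat \<Rightarrow> nat \<Rightarrow> real efun" where
  "gc Phi i j z x y = pdir i Phi z x y \<bullet> pdir j Phi z x y"

definition hxx where "hxx Phi = gc Phi 1 1"
definition hxy where "hxy Phi = gc Phi 1 2"
definition hyy where "hyy Phi = gc Phi 2 2"
definition hdet :: "(real^3) efun \<Rightarrow> real efun" where
  "hdet Phi z x y = hxx Phi z x y * hyy Phi z x y - (hxy Phi z x y)\<^sup>2"

definition hixx :: "(real^3) efun \<Rightarrow> real efun" where "hixx Phi z x y = hyy Phi z x y / hdet Phi z x y"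
definition hixy :: "(real^3) efun \<Rightarrow> real efun" where "hixy Phi z x y = - hxy Phi z x y / hdet Phi z x y"
definition hiyy :: "(real^3) efun \<Rightarrow> real efun" where "hiyy Phi z x y = hxx Phi z x y / hdet Phi z x y"

definition sharpx :: "(real^3) efun \<Rightarrow> real \<Rightarrow> real \<Rightarrow> real \<Rightarrow> real \<Rightarrow> real \<Rightarrow> real" where
  "sharpx Phi z x y a b = hixx Phi z x y * a + hixy Phi z x y * b"
definition sharpy :: "(real^3) efun \<Rightarrow> real \<Rightarrow> real \<Rightarrow> real \<Rightarrow> real \<Rightarrow> real \<Rightarrow> real" where
  "sharpy Phi z x y a b = hixy Phi z x y * a + hiyy Phi z x y * b"
definition flatx :: "(real^3) efun \<Rightarrow> real \<Rightarrow> real \<Rightarrow> real \<Rightarrow> real \<Rightarrow> real \<Rightarrow> real" where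
  "flatx Phi z x y v1 v2 = hxx Phi z x y * v1 + hxy Phi z x y * v2"
definition flaty :: "(real^3) efun \<Rightarrow> real \<Rightarrow> real \<Rightarrow> real \<Rightarrow> real \<Rightarrow> real \<Rightarrow> real" where
  "flaty Phi z x y v1 v2 = hxy Phi z x y * v1 + hyy Phi z x y * v2"
definition normsq1 :: "(real^3) efun \<Rightarrow> real \<Rightarrow> real \<Rightarrow> real \<Rightarrow> real \<Rightarrow> real \<Rightarrow> real" where
  "normsq1 Phi z x y a b = a * sharpx Phi z x y a b + b * sharpy Phi z x y a b"

text \<open>Shift vector \<open>N_zeta\<close> (solves \<open>h(N,.) = g~(d_zeta,.)\<close>) and squared lapse.\<close>
definition shiftx :: "(real^3) efun \<Rightarrow> real efun" where
  "shiftx Phi z x y = sharpx Phi z x y (gc Phi 0 1 z x y) (gc Phi 0 2 z x y)"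
definition shifty :: "(real^3) efun \<Rightarrow> real efun" where
  "shifty Phi z x y = sharpy Phi z x y (gc Phi 0 1 z x y) (gc Phi 0 2 z x y)"
definition lapse_sq :: "(real^3) efun \<Rightarrow> real efun" where
  "lapse_sq Phi z x y = gc Phi 0 0 z x y
     - (shiftx Phi z x y * flatx Phi z x y (shiftx Phi z x y) (shifty Phi z x y)
        + shifty Phi z x y * flaty Phi z x y (shiftx Phi z x y) (shifty Phi z x y))"

text \<open>\<open>omega_zeta = I_zeta^*(iota_{d_zeta} Omega)\<close>, coefficient of \<open>dx \<and> dy\<close>.\<close>
definition omega :: "(real^3) efun \<Rightarrow> real efun" where
  "omega Phi z x y = pz Phi z x y \<bullet> cross3 (px Phi z x y) (py Phi z x y)"

definition isothermal :: "(real^3) efun \<Rightarrow> bool" where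
  "isothermal Phi \<longleftrightarrow> (\<exists>f::real efun. \<forall>z x y. inD x y \<longrightarrow>
      f z x y \<noteq> 0 \<and> hxx Phi z x y = f z x y \<and> hyy Phi z x y = f z x y \<and> hxy Phi z x y = 0)"

text \<open>Boundary compatibility.  At a boundary point \<open>(zeta,x,y)\<close>, \<open>x^2+y^2=1\<close>, the tangent
space of the boundary of the cover is spanned by the images of \<open>d_zeta\<close> and of the boundary
tangent \<open>-y d_x + x d_y\<close>; their cross product is a (nonzero) multiple of the outward unit
normal \<open>n\<close>.  \<open>d zeta(n) = 0\<close> means that \<open>n\<close> is a combination of the images of \<open>d_x, d_y\<close>.\<close>
definition bdry_normal :: "(real^3) efun \<Rightarrow> (real^3) efun" where
  "bdry_normal Phi z x y = cross3 (pz Phi z x y) ((-y) *\<^sub>R px Phi z x y + x *\<^sub>R py Phi z x y)"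
definition boundary_compatible :: "(real^3) efun \<Rightarrow> bool" where
  "boundary_compatible Phi \<longleftrightarrow> (\<forall>z x y. onbd x y \<longrightarrow>
      (\<exists>a b. bdry_normal Phi z x y = a *\<^sub>R px Phi z x y + b *\<^sub>R py Phi z x y))"

definition euler_cond :: "(real^3) efun \<Rightarrow> real efun \<Rightarrow> real efun \<Rightarrow> real efun \<Rightarrow> real efun \<Rightarrow> bool" where
  "euler_cond Phi rho ux uy p \<longleftrightarrow>
    (let n = (\<lambda>z x y. rho z x y / omega Phi z x y);
         wx = (\<lambda>z x y. ux z x y + shiftx Phi z x y);
         wy = (\<lambda>z x y. uy z x y + shifty Phi z x y);
         pix = (\<lambda>z x y. n z x y * flatx Phi z x y (wx z x y) (wy z x y));
         piy = (\<lambda>z x y. n z x y * flaty Phi z x y (wx z x y) (wy z x y));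
         E = (\<lambda>z x y. normsq1 Phi z x y (pix z x y) (piy z x y) / n z x y
                      + n z x y * lapse_sq Phi z x y)
     in (\<forall>z x y. onbd x y \<longrightarrow> x * ux z x y + y * uy z x y = 0) \<and>
        (\<forall>z x y. inD x y \<longrightarrow>
           pz p z x y + ux z x y * px p z x y + uy z x y * py p z x y = 0 \<and>
           pz rho z x y + px (\<lambda>z x y. rho z x y * ux z x y) z x y
                        + py (\<lambda>z x y. rho z x y * uy z x y) z x y = 0 \<and>
           pz pix z x y + ux z x y * px pix z x y + uy z x y * py pix z x y
              + pix z x y * px ux z x y + piy z x y * px uy z x y
             = px p z x y / n z x y + px E z x y \<and>
           pz piy z x y + ux z x y * px piy z x y + uy z x y * py piy z x y
              + pix z x y * py ux z x y + piy z x y * py uy z x y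
             = py p z x y / n z x y + py E z x y))"

text \<open>Elements of \<open>p\<close>: \<open>(U^x, U^y, S, T)\<close>; elements of \<open>p*\<close>: \<open>(U_x, U_y, sigma, tau)\<close>
(coefficients w.r.t. \<open>dx \<and> dy\<close>).  Both are represented by the same record type.\<close>
record pel =
  pU1 :: sfun
  pU2 :: sfun
  pS :: sfun
  pT :: sfun

definition in_p :: "pel \<Rightarrow> bool" where
  "in_p X \<longleftrightarrow> smooth2 (pU1 X) \<and> smooth2 (pU2 X) \<and> smooth2 (pS X) \<and> smooth2 (pT X) \<and>
     (\<forall>x y. onbd x y \<longrightarrow> x * pU1 X x y + y * pU2 X x y = 0)"

definition in_pstar :: "pel \<Rightarrow> bool" where
  "in_pstar X \<longleftrightarrow> smooth2 (pU1 X) \<and> smooth2 (pU2 X) \<and> smooth2 (pS X) \<and> smooth2 (pT X) \<and>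
     (\<forall>x y. onbd x y \<longrightarrow> x * pU1 X x y + y * pU2 X x y = 0)"

definition padd :: "pel \<Rightarrow> pel \<Rightarrow> pel" where
  "padd A B = \<lparr>pU1 = \<lambda>x y. pU1 A x y + pU1 B x y, pU2 = \<lambda>x y. pU2 A x y + pU2 B x y,
               pS = \<lambda>x y. pS A x y + pS B x y, pT = \<lambda>x y. pT A x y + pT B x y\<rparr>"
definition pscale :: "real \<Rightarrow> pel \<Rightarrow> pel" where
  "pscale c A = \<lparr>pU1 = \<lambda>x y. c * pU1 A x y, pU2 = \<lambda>x y. c * pU2 A x y,
                 pS = \<lambda>x y. c * pS A x y, pT = \<lambda>x y. c * pT A x y\<rparr>"

definition pairing :: "pel \<Rightarrow> pel \<Rightarrow> real" where
  "pairing Xs X = integral Dset (\<lambda>q. pU1 Xs (fst q) (snd q) * pU1 X (fst q) (snd q)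
        + pU2 Xs (fst q) (snd q) * pU2 X (fst q) (snd q)
        + pS Xs (fst q) (snd q) * pS X (fst q) (snd q)
        + pT Xs (fst q) (snd q) * pT X (fst q) (snd q))"

definition lie_fun :: "sfun \<Rightarrow> sfun \<Rightarrow> sfun \<Rightarrow> sfun" where
  "lie_fun u1 u2 s x y = u1 x y * dx2 s x y + u2 x y * dy2 s x y"

definition pbracket :: "pel \<Rightarrow> pel \<Rightarrow> pel" where
  "pbracket A B =
    \<lparr>pU1 = \<lambda>x y. - (lie_fun (pU1 A) (pU2 A) (pU1 B) x y - lie_fun (pU1 B) (pU2 B) (pU1 A) x y),
     pU2 = \<lambda>x y. - (lie_fun (pU1 A) (pU2 A) (pU2 B) x y - lie_fun (pU1 B) (pU2 B) (pU2 A) x y),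
     pS = \<lambda>x y. - (lie_fun (pU1 A) (pU2 A) (pS B) x y - lie_fun (pU1 B) (pU2 B) (pS A) x y),
     pT = \<lambda>x y. - (lie_fun (pU1 A) (pU2 A) (pT B) x y - lie_fun (pU1 B) (pU2 B) (pT A) x y)\<rparr>"

definition is_fderiv :: "(pel \<Rightarrow> real) \<Rightarrow> pel \<Rightarrow> pel \<Rightarrow> bool" where
  "is_fderiv F Xs D \<longleftrightarrow> in_p D \<and>
     (\<forall>dX. in_pstar dX \<longrightarrow>
        ((\<lambda>l. F (padd Xs (pscale l dX))) has_real_derivative pairing dX D) (at 0))"

definition smooth_curve :: "(real \<Rightarrow> pel) \<Rightarrow> bool" where
  "smooth_curve Y \<longleftrightarrow> (\<forall>z. in_pstar (Y z)) \<and>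
     smooth3 (\<lambda>z x y. pU1 (Y z) x y) \<and> smooth3 (\<lambda>z x y. pU2 (Y z) x y) \<and>
     smooth3 (\<lambda>z x y. pS (Y z) x y) \<and> smooth3 (\<lambda>z x y. pT (Y z) x y)"

definition dcurve :: "(real \<Rightarrow> pel) \<Rightarrow> real \<Rightarrow> pel" where
  "dcurve Y z0 = \<lparr>pU1 = pz (\<lambda>z x y. pU1 (Y z) x y) z0, pU2 = pz (\<lambda>z x y. pU2 (Y z) x y) z0,
                  pS = pz (\<lambda>z x y. pS (Y z) x y) z0, pT = pz (\<lambda>z x y. pT (Y z) x y) z0\<rparr>"

text \<open>Admissible functionals: along every smooth curve in \<open>p*\<close> they have a functional
derivative and obey the chain rule (this class contains all linear functionals
\<open>X* \<mapsto> <X*, X>\<close>, \<open>X \<in> p\<close>).\<close>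
definition admissible :: "(pel \<Rightarrow> real) \<Rightarrow> bool" where
  "admissible F \<longleftrightarrow> (\<forall>Y. smooth_curve Y \<longrightarrow> (\<forall>z. \<exists>D. is_fderiv F (Y z) D \<and>
       ((\<lambda>t. F (Y t)) has_real_derivative pairing (dcurve Y z) D) (at z)))"

definition hamilton :: "(real \<Rightarrow> pel \<Rightarrow> real) \<Rightarrow> (real \<Rightarrow> pel) \<Rightarrow> bool" where
  "hamilton H X \<longleftrightarrow> smooth_curve X \<and>
     (\<forall>z. \<exists>DH. is_fderiv (H z) (X z) DH \<and>
        (\<forall>F DF. admissible F \<longrightarrow> is_fderiv F (X z) DF \<longrightarrow>
           ((\<lambda>t. F (X t)) has_real_derivative pairing (X z) (pbracket DF DH)) (at z)))"

definition Ham :: "(real^3) efun \<Rightarrow> real \<Rightarrow> pel \<Rightarrow> real" where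
  "Ham Phi z X = integral Dset (\<lambda>q. let x = fst q; y = snd q;
        s = pS X x y; w = omega Phi z x y in
      (1/2 * normsq1 Phi z x y (pU1 X x y / s) (pU2 X x y / s) + pT X x y / s
        - 1/2 * (s / w)\<^sup>2 * lapse_sq Phi z x y) * w
      - (pU1 X x y * shiftx Phi z x y + pU2 X x y * shifty Phi z x y))"

end

theory Submission
  imports Defs
begin

text \<open>On the disc, (ii) forces \<open>X\<^sup>* = (\<varrho> \<pi>, \<varrho>, \<varrho> p)\<close>, and boundary compatibility makes the shift tangent to the
  boundary, so \<open>u\<close> is tangent exactly when \<open>X\<^sup>*\<close> lies in the dual. The functional derivative of the Hamiltonian there
  is \<open>(u, -E - p/n, 1/n)\<close> with \<open>E = |\<pi>|\<^sup>2/n + n N\<^sup>2\<close>. Functional derivatives are determined on the disc, and the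
  linear functionals are admissible, so Hamilton's equations are an identity tested against all of \<open>\<pp>\<close>.
  Integrating by parts (\<open>u\<close> is tangent) and testing with \<open>(1 - r\<^sup>2)\<close> times the residual turns it into pointwise
  equations, which are \<open>\<varrho>\<close> times (i) up to multiples of the continuity equation.

  All objects must be smooth on the whole plane, while \<open>1/\<omega>\<close>, \<open>1/\<varrho>\<close> and the inverse metric are only defined near
  the disc. A nonvanishing \<open>a\<close> with \<open>|a| > c\<close> has the reciprocal extension \<open>a / (a\<^sup>2 + h (c\<^sup>2 - a\<^sup>2))\<close>, where
  \<open>h t = exp (-1/t)\<close> for \<open>t > 0\<close> and \<open>h t = 0\<close> otherwise. It is exact on a neighbourhood of the disc, so the
  boundary values of the derivatives, which see the formulas off the disc, are unaffected.\<close>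

subsection \<open>Calculus of smooth functions\<close>

definition has_pdir ::
  "nat \<Rightarrow> 'a::real_normed_vector efun \<Rightarrow> real \<Rightarrow> real \<Rightarrow> real \<Rightarrow> 'a \<Rightarrow> bool" where
  "has_pdir d f z x y D =
     (if d = 0 then ((\<lambda>t. f t x y) has_vector_derivative D) (at z)
      else if d = 1 then ((\<lambda>t. f z t y) has_vector_derivative D) (at x)
      else ((\<lambda>t. f z x t) has_vector_derivative D) (at y))"

lemma has_pdir_imp_pdir: "has_pdir d f z x y D \<Longrightarrow> pdir d f z x y = D"
  by (auto simp: has_pdir_def pdir_def pz_def px_def py_def vector_derivative_at split: if_splits)

lemma has_pdir_imp_pdiff_ok: "has_pdir d f z x y D \<Longrightarrow> pdiff_ok d f z x y"
  by (auto simp: has_pdir_def pdiff_ok_def differentiableI_vector split: if_splits)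

lemma pdiff_ok_imp_has_pdir: "pdiff_ok d f z x y \<Longrightarrow> has_pdir d f z x y (pdir d f z x y)"
  by (auto simp: has_pdir_def pdir_def pz_def px_def py_def pdiff_ok_def
      vector_derivative_works split: if_splits)

lemma has_pdir_const: "has_pdir d (\<lambda>z x y. c) z x y 0"
  by (simp add: has_pdir_def)

lemma has_pdir_add:
  "has_pdir d f z x y D \<Longrightarrow> has_pdir d g z x y D' \<Longrightarrow>
   has_pdir d (\<lambda>z x y. f z x y + g z x y) z x y (D + D')"
  by (auto simp: has_pdir_def intro: has_vector_derivative_add split: if_splits)

lemma has_pdir_bilinear:
  assumes "bounded_bilinear B" "has_pdir d f z x y D" "has_pdir d g z x y D'"
  shows "has_pdir d (\<lambda>z x y. B (f z x y) (g z x y)) z x y (B (f z x y) D' + B D (g z x y))"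
  using assms
  by (auto simp: has_pdir_def intro!: bounded_bilinear.has_vector_derivative split: if_splits)

lemma has_pdir_mult:
  fixes f g :: "real efun"
  shows "has_pdir d f z x y D \<Longrightarrow> has_pdir d g z x y D' \<Longrightarrow>
   has_pdir d (\<lambda>z x y. f z x y * g z x y) z x y (f z x y * D' + D * g z x y)"
  by (rule has_pdir_bilinear[OF bounded_bilinear_mult])

lemma has_pdir_comp:
  assumes "has_pdir d f z x y D" "(g has_real_derivative g') (at (f z x y))"
  shows "has_pdir d (\<lambda>z x y. g (f z x y)) z x y (D * g')"
proof -
  have g: "(g has_vector_derivative g') (at (f z x y))"
    using assms(2) by (simp add: has_real_derivative_iff_has_vector_derivative)
  show ?thesis
    using assms(1) g vector_diff_chain_at[of "\<lambda>t. f t x y" D z g g']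
      vector_diff_chain_at[of "\<lambda>t. f z t y" D x g g']
      vector_diff_chain_at[of "\<lambda>t. f z x t" D y g g']
    by (auto simp: has_pdir_def o_def split: if_splits)
qed

lemma has_pdir_transform_open:
  assumes "has_pdir d f z x y D" "open W" "(z, x, y) \<in> W"
    "\<And>z x y. (z, x, y) \<in> W \<Longrightarrow> f z x y = g z x y"
  shows "has_pdir d g z x y D"
proof -
  have o: "open ((\<lambda>t. (t, x, y)) -` W)" "open ((\<lambda>t. (z, t, y)) -` W)" "open ((\<lambda>t. (z, x, t)) -` W)"
    by (auto intro!: open_vimage assms(2) continuous_intros)
  show ?thesis
    using assms(1,3,4) has_vector_derivative_transform_within_open[OF _ o(1), of "\<lambda>t. f t x y" D z "\<lambda>t. g t x y"]
      has_vector_derivative_transform_within_open[OF _ o(2), of "\<lambda>t. f z t y" D x "\<lambda>t. g z t y"]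
      has_vector_derivative_transform_within_open[OF _ o(3), of "\<lambda>t. f z x t" D y "\<lambda>t. g z x t"]
    by (auto simp: has_pdir_def split: if_splits)
qed

definition cont3 :: "'a::real_normed_vector efun \<Rightarrow> bool" where
  "cont3 f = continuous_on UNIV (\<lambda>(z, x, y). f z x y)"

lemma cont3_continuous_on:
  assumes "cont3 f" "continuous_on S a" "continuous_on S b" "continuous_on S c"
  shows "continuous_on S (\<lambda>q. f (a q) (b q) (c q))"
proof -
  have "continuous_on S ((\<lambda>(z, x, y). f z x y) \<circ> (\<lambda>q. (a q, b q, c q)))"
    using assms by (intro continuous_on_compose continuous_on_Pair)
      (auto simp: cont3_def intro: continuous_on_subset)
  then show ?thesis by (simp add: o_def)
qed

lemma cont3I:
  assumes "continuous_on UNIV (\<lambda>q. f (fst q) (fst (snd q)) (snd (snd q)))"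
  shows "cont3 f"
  using assms by (simp add: cont3_def case_prod_unfold)

lemma cont3_uncurry:
  "cont3 f \<Longrightarrow> continuous_on S (\<lambda>q. f (fst q) (fst (snd q)) (snd (snd q)))"
  unfolding cont3_def case_prod_unfold by (rule continuous_on_subset) auto

lemma cont3_bilinear:
  assumes "bounded_bilinear B" "cont3 f" "cont3 g"
  shows "cont3 (\<lambda>z x y. B (f z x y) (g z x y))"
  by (rule cont3I, rule bounded_bilinear.continuous_on[OF assms(1)
        cont3_uncurry[OF assms(2)] cont3_uncurry[OF assms(3)]])

lemma cont3_add:
  assumes "cont3 f" "cont3 g"
  shows "cont3 (\<lambda>z x y. f z x y + g z x y)"
  by (rule cont3I, rule continuous_on_add[OF cont3_uncurry[OF assms(1)] cont3_uncurry[OF assms(2)]])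

lemma cont3_inverse:
  fixes f :: "real efun"
  assumes "cont3 f" "\<And>z x y. f z x y \<noteq> 0"
  shows "cont3 (\<lambda>z x y. inverse (f z x y))"
  by (rule cont3I, rule continuous_on_inverse[OF cont3_uncurry[OF assms(1)]]) (simp add: assms(2))

lemma cont3_slice:
  assumes "cont3 f"
  shows "cont3 (\<lambda>z x y. f c x y)"
  by (rule cont3I, rule cont3_continuous_on[OF assms]) (auto intro!: continuous_intros)

text \<open>A version of \<open>smooth3\<close> graded by the order of differentiability, so that closure
  properties can be proved by induction on the order.\<close>

fun Ck :: "nat \<Rightarrow> 'a::real_normed_vector efun \<Rightarrow> bool" where
  "Ck 0 f = cont3 f"
| "Ck (Suc n) f = (cont3 f \<and> (\<forall>d z x y. pdiff_ok d f z x y) \<and> (\<forall>d. Ck n (pdir d f)))"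

lemma pdiff_ok_ge: "\<not> d < 3 \<Longrightarrow> pdiff_ok d f z x y = pdiff_ok 2 f z x y"
  by (simp add: pdiff_ok_def)

lemma smooth3_imp_pdiff_ok: "smooth3 f \<Longrightarrow> pdiff_ok d f z x y"
proof -
  assume "smooth3 f"
  then have "\<forall>d<3. pdiff_ok d f z x y"
    unfolding smooth3_def by (elim allE[of _ "[]"]) simp
  then show ?thesis using pdiff_ok_ge[of d f z x y] by (cases "d < 3") auto
qed

lemma smooth3_imp_cont3: "smooth3 f \<Longrightarrow> cont3 f"
  unfolding smooth3_def cont3_def by (elim allE[of _ "[]"]) simp

lemma smooth3_pdir: "smooth3 f \<Longrightarrow> smooth3 (pdir d f)"
  unfolding smooth3_def
proof (intro allI)
  fix ds
  assume a: "\<forall>ds. (\<forall>d<3. \<forall>z x y. pdiff_ok d (foldr pdir ds f) z x y) \<and>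
      continuous_on UNIV (\<lambda>(z, x, y). foldr pdir ds f z x y)"
  show "(\<forall>da<3. \<forall>z x y. pdiff_ok da (foldr pdir ds (pdir d f)) z x y) \<and>
      continuous_on UNIV (\<lambda>(z, x, y). foldr pdir ds (pdir d f) z x y)"
    using a[rule_format, of "ds @ [d]"] by simp
qed

lemma Ck_foldr: "(\<And>n. Ck n f) \<Longrightarrow> Ck n (foldr pdir ds f)"
proof (induction ds arbitrary: n)
  case (Cons d ds)
  have "Ck (Suc n) (foldr pdir ds f)" using Cons by blast
  then show ?case by simp
qed simp

lemma smooth3_iff_Ck: "smooth3 f \<longleftrightarrow> (\<forall>n. Ck n f)"
proof
  have "smooth3 f \<Longrightarrow> Ck n f" for n
  proof (induction n arbitrary: f)
    case 0 then show ?case by (simp add: smooth3_imp_cont3)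
  next
    case (Suc n)
    then have "\<forall>d z x y. pdiff_ok d f z x y" by (intro allI smooth3_imp_pdiff_ok)
    then show ?case using Suc by (simp add: smooth3_imp_cont3 smooth3_pdir)
  qed
  then show "smooth3 f \<Longrightarrow> \<forall>n. Ck n f" by blast
next
  assume a: "\<forall>n. Ck n f"
  show "smooth3 f" unfolding smooth3_def
  proof
    fix ds
    have "Ck (Suc 0) (foldr pdir ds f)" using a Ck_foldr by blast
    then show "(\<forall>d<3. \<forall>z x y. pdiff_ok d (foldr pdir ds f) z x y) \<and>
      continuous_on UNIV (\<lambda>(z, x, y). foldr pdir ds f z x y)"
      by (simp add: cont3_def)
  qed
qed

lemma Ck_SucI:
  assumes "cont3 f" "\<And>d z x y. has_pdir d f z x y (f' d z x y)" "\<And>d. Ck n (f' d)"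
  shows "Ck (Suc n) f"
proof -
  have "pdir d f = f' d" for d
    using assms(2) by (intro ext has_pdir_imp_pdir)
  then show ?thesis using assms has_pdir_imp_pdiff_ok[OF assms(2)] by auto
qed

lemma Ck_SucD:
  assumes "Ck (Suc n) f"
  shows "Ck n f"
  using assms
proof (induction n arbitrary: f)
  case (Suc n)
  then have "Ck n (pdir d f)" for d by (metis Ck.simps(2))
  then show ?case using Suc.prems by auto
qed auto

lemma Ck_cont3: "Ck n f \<Longrightarrow> cont3 f"
  by (cases n) auto

lemma Ck_has_pdir: "Ck (Suc n) f \<Longrightarrow> has_pdir d f z x y (pdir d f z x y)"
  by (simp add: pdiff_ok_imp_has_pdir)

lemma Ck_const: "Ck n (\<lambda>z x y. c)"
proof (induction n arbitrary: c)
  case 0 show ?case by (auto intro!: cont3I continuous_intros)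
next
  case (Suc n)
  show ?case
    by (rule Ck_SucI[where f' = "\<lambda>d z x y. 0"]) (auto intro!: cont3I continuous_intros has_pdir_const Suc)
qed

lemma Ck_add:
  "Ck n f \<Longrightarrow> Ck n g \<Longrightarrow> Ck n (\<lambda>z x y. f z x y + g z x y)"
proof (induction n arbitrary: f g)
  case 0
  then show ?case by (simp add: cont3_add)
next
  case (Suc n)
  show ?case
  proof (rule Ck_SucI[where f' = "\<lambda>d z x y. pdir d f z x y + pdir d g z x y"])
    show "cont3 (\<lambda>z x y. f z x y + g z x y)"
      using Suc.prems[THEN Ck_cont3] by (rule cont3_add)
    show "has_pdir d (\<lambda>z x y. f z x y + g z x y) z x y (pdir d f z x y + pdir d g z x y)" for d z x y
      by (intro has_pdir_add Ck_has_pdir[OF Suc.prems(1)] Ck_has_pdir[OF Suc.prems(2)])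
  qed (use Suc in auto)
qed

lemma Ck_bilinear:
  assumes B: "bounded_bilinear B"
  shows "Ck n f \<Longrightarrow> Ck n g \<Longrightarrow> Ck n (\<lambda>z x y. B (f z x y) (g z x y))"
proof (induction n arbitrary: f g)
  case 0
  then show ?case by (simp add: cont3_bilinear[OF B])
next
  case (Suc n)
  show ?case
  proof (rule Ck_SucI[where f' = "\<lambda>d z x y. B (f z x y) (pdir d g z x y) + B (pdir d f z x y) (g z x y)"])
    show "cont3 (\<lambda>z x y. B (f z x y) (g z x y))"
      using Suc.prems[THEN Ck_cont3] by (rule cont3_bilinear[OF B])
    show "has_pdir d (\<lambda>z x y. B (f z x y) (g z x y)) z x y
        (B (f z x y) (pdir d g z x y) + B (pdir d f z x y) (g z x y))" for d z x y
      by (rule has_pdir_bilinear[OF B Ck_has_pdir[OF Suc.prems(1)] Ck_has_pdir[OF Suc.prems(2)]])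
    show "Ck n (\<lambda>z x y. B (f z x y) (pdir d g z x y) + B (pdir d f z x y) (g z x y))" for d
      using Suc.prems by (intro Ck_add Suc.IH) (auto intro: Ck_SucD)
  qed
qed

lemma Ck_comp_family:
  fixes g :: "'i \<Rightarrow> real \<Rightarrow> real"
  assumes g: "\<And>i t. (g i has_real_derivative g (s i) t) (at t)"
  shows "Ck n f \<Longrightarrow> Ck n (\<lambda>z x y. g i (f z x y))"
proof (induction n arbitrary: i)
  have "continuous_on UNIV (g i)" for i
    by (rule DERIV_continuous_on) (rule has_field_derivative_at_within[OF g])
  then have "cont3 f \<Longrightarrow> continuous_on UNIV (g i \<circ> (\<lambda>(z, x, y). f z x y))" for i
    unfolding cont3_def by (blast intro: continuous_on_compose continuous_on_subset)
  then have c: "cont3 f \<Longrightarrow> cont3 (\<lambda>z x y. g i (f z x y))" for i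
    by (simp add: cont3_def o_def case_prod_unfold)
  {
    case 0
    then show ?case using c by auto
  next
    case (Suc n)
    show ?case
    proof (rule Ck_SucI[where f' = "\<lambda>d z x y. pdir d f z x y * g (s i) (f z x y)"])
      show "cont3 (\<lambda>z x y. g i (f z x y))" using Suc.prems c by auto
      show "has_pdir d (\<lambda>z x y. g i (f z x y)) z x y (pdir d f z x y * g (s i) (f z x y))" for d z x y
        by (rule has_pdir_comp[OF Ck_has_pdir[OF Suc.prems] g])
      have "Ck n (\<lambda>z x y. g (s i) (f z x y))" "Ck n (pdir d f)" for d
        using Suc.prems Suc.IH[OF Ck_SucD[OF Suc.prems]] by simp_all
      then show "Ck n (\<lambda>z x y. pdir d f z x y * g (s i) (f z x y))" for d
        using Ck_bilinear[OF bounded_bilinear_mult] by blast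
    qed
  }
qed

lemma smooth3_const [simp]: "smooth3 (\<lambda>z x y. c)"
  by (simp add: smooth3_iff_Ck Ck_const)

lemma smooth3_add: "smooth3 f \<Longrightarrow> smooth3 g \<Longrightarrow> smooth3 (\<lambda>z x y. f z x y + g z x y)"
  by (simp add: smooth3_iff_Ck Ck_add)

lemma smooth3_bilinear:
  "bounded_bilinear B \<Longrightarrow> smooth3 f \<Longrightarrow> smooth3 g \<Longrightarrow> smooth3 (\<lambda>z x y. B (f z x y) (g z x y))"
  by (simp add: smooth3_iff_Ck Ck_bilinear)

lemma smooth3_mult:
  fixes f g :: "real efun"
  shows "smooth3 f \<Longrightarrow> smooth3 g \<Longrightarrow> smooth3 (\<lambda>z x y. f z x y * g z x y)"
  by (rule smooth3_bilinear[OF bounded_bilinear_mult])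

lemma smooth3_uminus:
  fixes f :: "real efun"
  shows "smooth3 f \<Longrightarrow> smooth3 (\<lambda>z x y. - f z x y)"
  using smooth3_mult[of "\<lambda>z x y. -1" f] by simp

lemma smooth3_diff:
  fixes f g :: "real efun"
  shows "smooth3 f \<Longrightarrow> smooth3 g \<Longrightarrow> smooth3 (\<lambda>z x y. f z x y - g z x y)"
  using smooth3_add[of f "\<lambda>z x y. - g z x y"] smooth3_uminus[of g] by simp

lemma smooth3_power:
  fixes f :: "real efun"
  shows "smooth3 f \<Longrightarrow> smooth3 (\<lambda>z x y. f z x y ^ n)"
  by (induction n) (auto intro: smooth3_mult)

lemma smooth3_I:
  assumes "cont3 f" "\<And>d z x y. has_pdir d f z x y (f' d z x y)" "\<And>d. smooth3 (f' d)"
  shows "smooth3 f"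
  unfolding smooth3_iff_Ck
proof
  fix n show "Ck n f"
    using assms Ck_SucI[of f f'] by (cases n) (auto simp: smooth3_iff_Ck)
qed

lemma smooth3_x: "smooth3 (\<lambda>z x y. x)"
proof (rule smooth3_I[where f' = "\<lambda>d z x y. if d = 1 then 1 else 0"])
  show "smooth3 (\<lambda>z x y. if d = (1::nat) then 1 else 0 :: real)" for d by (rule smooth3_const)
qed (auto intro!: cont3I continuous_intros simp: has_pdir_def)

lemma smooth3_y: "smooth3 (\<lambda>z x y. y)"
proof (rule smooth3_I[where f' = "\<lambda>d z x y. if d = 0 \<or> d = 1 then 0 else 1"])
  show "smooth3 (\<lambda>z x y. if d = (0::nat) \<or> d = 1 then 0 else 1 :: real)" for d by (rule smooth3_const)
qed (auto intro!: cont3I continuous_intros simp: has_pdir_def)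

lemma smooth3_has_pdir: "smooth3 f \<Longrightarrow> has_pdir d f z x y (pdir d f z x y)"
  by (simp add: pdiff_ok_imp_has_pdir smooth3_imp_pdiff_ok)

lemma pdir_simps: "pdir 0 = pz" "pdir 1 = px" "pdir (Suc 0) = px" "pdir 2 = py"
  by (auto simp: pdir_def fun_eq_iff)

lemma smooth3_pz: "smooth3 f \<Longrightarrow> smooth3 (pz f)"
  and smooth3_px: "smooth3 f \<Longrightarrow> smooth3 (px f)"
  and smooth3_py: "smooth3 f \<Longrightarrow> smooth3 (py f)"
  using smooth3_pdir[of f 0] smooth3_pdir[of f 1] smooth3_pdir[of f 2] by (simp_all add: pdir_simps)

lemma smooth3_comp_family:
  fixes g :: "'i \<Rightarrow> real \<Rightarrow> real"
  assumes "\<And>i t. (g i has_real_derivative g (s i) t) (at t)" "smooth3 f"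
  shows "smooth3 (\<lambda>z x y. g i (f z x y))"
  using Ck_comp_family[of g s, OF assms(1)] assms(2) by (simp add: smooth3_iff_Ck)

lemma Ck_inverse:
  fixes f :: "real efun"
  assumes nz: "\<And>z x y. f z x y \<noteq> 0"
  shows "Ck n f \<Longrightarrow> Ck n (\<lambda>z x y. inverse (f z x y))"
proof (induction n)
  case 0
  then show ?case
    using nz by (simp add: cont3_inverse)
next
  case (Suc n)
  show ?case
  proof (rule Ck_SucI[where f' = "\<lambda>d z x y. pdir d f z x y * ((-1) * (inverse (f z x y) * inverse (f z x y)))"])
    show "cont3 (\<lambda>z x y. inverse (f z x y))"
      using nz Suc.prems[THEN Ck_cont3] by (simp add: cont3_inverse)
    show "has_pdir d (\<lambda>z x y. inverse (f z x y)) z x y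
        (pdir d f z x y * ((-1) * (inverse (f z x y) * inverse (f z x y))))" for d z x y
      by (rule has_pdir_comp[OF Ck_has_pdir[OF Suc.prems]])
        (use DERIV_inverse[OF nz, of z x y] in \<open>simp add: power2_eq_square\<close>)
    show "Ck n (\<lambda>z x y. pdir d f z x y * ((-1) * (inverse (f z x y) * inverse (f z x y))))" for d
    proof -
      have i: "Ck n (\<lambda>z x y. inverse (f z x y))" by (rule Suc.IH[OF Ck_SucD[OF Suc.prems]])
      have d: "Ck n (pdir d f)" using Suc.prems by simp
      note m = Ck_bilinear[OF bounded_bilinear_mult]
      show ?thesis by (rule m[OF d m[OF Ck_const m[OF i i]]])
    qed
  qed
qed

lemma smooth3_inverse:
  fixes f :: "real efun"
  shows "(\<And>z x y. f z x y \<noteq> 0) \<Longrightarrow> smooth3 f \<Longrightarrow> smooth3 (\<lambda>z x y. inverse (f z x y))"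
  by (simp add: smooth3_iff_Ck Ck_inverse)

lemma Ck_slice: "Ck n f \<Longrightarrow> Ck n (\<lambda>z x y. f c x y)"
proof (induction n arbitrary: f)
  case 0
  then show ?case by (simp add: cont3_slice)
next
  case (Suc n)
  show ?case
  proof (rule Ck_SucI[where f' = "\<lambda>d. if d = 0 then (\<lambda>z x y. 0) else (\<lambda>z x y. pdir d f c x y)"])
    show "cont3 (\<lambda>z x y. f c x y)"
      by (rule cont3_slice[OF Suc.prems[THEN Ck_cont3]])
    show "has_pdir d (\<lambda>z x y. f c x y) z x y
        ((if d = 0 then (\<lambda>z x y. 0) else (\<lambda>z x y. pdir d f c x y)) z x y)" for d z x y
      using Ck_has_pdir[OF Suc.prems, of d c x y] by (auto simp: has_pdir_def)
    show "Ck n (if d = 0 then (\<lambda>z x y. 0) else (\<lambda>z x y. pdir d f c x y))" for d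
      using Suc by (auto intro: Ck_const)
  qed
qed

lemma smooth2_slice: "smooth3 f \<Longrightarrow> smooth2 (f z)"
  by (simp add: smooth2_def smooth3_iff_Ck Ck_slice)

subsection \<open>Smooth extension of reciprocals\<close>

text \<open>The functions \<open>p(1/t) exp(-1/t)\<close>, extended by \<open>0\<close>, are closed under differentiation.\<close>

definition flat_fun :: "real poly \<Rightarrow> real \<Rightarrow> real" where
  "flat_fun p t = (if t > 0 then poly p (1/t) * exp (-1/t) else 0)"

definition flat_step :: "real poly \<Rightarrow> real poly" where
  "flat_step p = [:0,0,1:] * (p - pderiv p)"

lemma poly_times_exp_tendsto_0: "((\<lambda>s. poly p s * exp (-s)) \<longlongrightarrow> (0::real)) at_top"
proof -
  have "((\<lambda>s. \<Sum>i\<le>degree p. coeff p i * (s ^ i / exp s)) \<longlongrightarrow> (\<Sum>i\<le>degree p. coeff p i * 0)) at_top"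
    by (intro tendsto_intros tendsto_power_div_exp_0)
  moreover have "(\<Sum>i\<le>degree p. coeff p i * (s ^ i / exp s)) = poly p s * exp (-s)" for s :: real
    by (simp add: poly_altdef sum_distrib_right exp_minus divide_inverse mult.assoc)
  ultimately show ?thesis by simp
qed

lemma flat_fun_deriv: "(flat_fun p has_real_derivative flat_fun (flat_step p) t) (at t)"
proof -
  consider "t > 0" | "t < 0" | "t = 0" by linarith
  then show ?thesis
  proof cases
    case 1
    have "((\<lambda>t. poly p (1/t) * exp (-1/t)) has_real_derivative
       poly (pderiv p) (1/t) * (-1/t^2) * exp (-1/t) + poly p (1/t) * (exp (-1/t) * (1/t^2))) (at t)"
      using 1 by (auto intro!: derivative_eq_intros DERIV_chain'[OF _ poly_DERIV]
          simp: field_simps power2_eq_square)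
    moreover have "poly (pderiv p) (1/t) * (-1/t^2) * exp (-1/t) + poly p (1/t) * (exp (-1/t) * (1/t^2))
      = flat_fun (flat_step p) t"
      using 1 by (simp add: flat_fun_def flat_step_def field_simps power2_eq_square)
    ultimately show ?thesis
      using 1 has_field_derivative_transform_within_open[of "\<lambda>t. poly p (1/t) * exp (-1/t)" _ t "{0<..}" "flat_fun p"]
      by (auto simp: flat_fun_def)
  next
    case 2
    have "((\<lambda>t. 0) has_real_derivative 0) (at t)" by simp
    then show ?thesis
      using 2 has_field_derivative_transform_within_open[of "\<lambda>t. 0" 0 t "{..<0}" "flat_fun p"]
      by (auto simp: flat_fun_def)
  next
    case 3
    let ?q = "\<lambda>h. (flat_fun p h - flat_fun p 0) / h"
    have "((\<lambda>s. poly ([:0,1:] * p) s * exp (-s)) \<longlongrightarrow> 0) at_top" by (rule poly_times_exp_tendsto_0)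
    then have "((\<lambda>h. poly ([:0,1:] * p) (inverse h) * exp (- inverse h)) \<longlongrightarrow> 0) (at_right 0)"
      by (rule filterlim_compose) (rule filterlim_inverse_at_top_right)
    then have r: "(?q \<longlongrightarrow> 0) (at_right 0)"
      by (rule filterlim_cong[THEN iffD1, rotated -1])
        (auto simp: flat_fun_def eventually_at_filter field_simps intro!: always_eventually)
    have l: "(?q \<longlongrightarrow> 0) (at_left 0)"
      by (rule tendsto_eventually) (auto simp: flat_fun_def eventually_at_filter)
    have "(?q \<longlongrightarrow> 0) (at 0)" using l r by (simp add: filterlim_at_split)
    moreover have "flat_fun (flat_step p) t = 0" using 3 by (simp add: flat_fun_def)
    ultimately show ?thesis using 3 by (simp add: DERIV_def)
  qed
qed

lemma flat_fun_1: "flat_fun 1 t = (if t > 0 then exp (-1/t) else 0)"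
  by (simp add: flat_fun_def)

lemma smooth3_reciprocal_extension:
  fixes a :: "real efun"
  assumes a: "smooth3 a" and c: "c > 0"
  obtains b where "smooth3 b" "\<And>z x y. \<bar>a z x y\<bar> > c \<Longrightarrow> b z x y = 1 / a z x y"
proof -
  define D where "D z x y = (a z x y)\<^sup>2 + flat_fun 1 (c\<^sup>2 - (a z x y)\<^sup>2)" for z x y
  have pos: "D z x y > 0" for z x y
  proof (cases "a z x y = 0")
    case False
    then show ?thesis by (simp add: D_def flat_fun_1 add_pos_nonneg)
  qed (use c in \<open>auto simp: D_def flat_fun_1\<close>)
  have "smooth3 D" unfolding D_def
    by (intro smooth3_add smooth3_power a smooth3_diff smooth3_const
        smooth3_comp_family[where g = flat_fun and s = flat_step] flat_fun_deriv)
  then have "smooth3 (\<lambda>z x y. a z x y * inverse (D z x y))"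
    using pos by (intro smooth3_mult a smooth3_inverse) (auto simp: less_imp_neq[symmetric])
  moreover have "a z x y * inverse (D z x y) = 1 / a z x y" if "\<bar>a z x y\<bar> > c" for z x y
  proof -
    have "c\<^sup>2 \<le> (a z x y)\<^sup>2" using that c by (metis abs_le_square_iff abs_of_pos less_imp_le)
    then have "D z x y = (a z x y)\<^sup>2" by (simp add: D_def flat_fun_1)
    then show ?thesis using that c by (simp add: power2_eq_square field_simps)
  qed
  ultimately show ?thesis using that by blast
qed

subsection \<open>Integration over the disc\<close>

lemma Dset_eq_cball: "Dset = cball 0 1"
  by (auto simp: Dset_def inD_def norm_Pair)

lemma compact_Dset: "compact Dset"
  by (simp add: Dset_eq_cball)

lemma integrable_on_compact:
  fixes f :: "'a::euclidean_space \<Rightarrow> real"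
  assumes "compact K" "continuous_on K f"
  shows "f integrable_on K"
  using borel_integrable_compact[OF assms] set_borel_integral_eq_integral(1)[of K f]
  by (simp add: set_integrable_def)

lemma has_derivative_integral_compact:
  fixes f f' :: "real \<Rightarrow> 'a::euclidean_space \<Rightarrow> real"
  assumes K: "compact K" and e: "e > 0"
    and d: "\<And>t q. \<bar>t - t0\<bar> \<le> e \<Longrightarrow> q \<in> K \<Longrightarrow> ((\<lambda>t. f t q) has_real_derivative f' t q) (at t)"
    and cf: "\<And>t. \<bar>t - t0\<bar> \<le> e \<Longrightarrow> continuous_on K (f t)"
    and cf': "continuous_on ({t0 - e..t0 + e} \<times> K) (\<lambda>(t, q). f' t q)"
  shows "((\<lambda>t. integral K (f t)) has_real_derivative integral K (f' t0)) (at t0)"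
proof -
  have c0: "continuous_on K (f' t0)"
  proof -
    have "continuous_on K ((\<lambda>(t, q). f' t q) \<circ> (\<lambda>q. (t0, q)))"
      using e by (intro continuous_on_compose continuous_intros continuous_on_subset[OF cf']) auto
    then show ?thesis by (simp add: o_def)
  qed
  define m where "m = measure lebesgue K"
  have m: "integral K (\<lambda>q. c) = c * m" for c :: real
    using lmeasurable_compact[OF K] integral_mult_right[of K c "\<lambda>_. 1::real"]
    by (simp add: m_def lmeasure_integral)
  have m0: "m \<ge> 0" by (simp add: m_def)
  have uc: "uniformly_continuous_on ({t0 - e..t0 + e} \<times> K) (\<lambda>(t, q). f' t q)"
    using cf' K by (intro compact_uniformly_continuous compact_Times) auto
  show ?thesis unfolding DERIV_def
  proof (rule LIM_I)
    fix r :: real assume r: "0 < r"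
    define \<epsilon> where "\<epsilon> = r / (m + 1)"
    have \<epsilon>: "\<epsilon> > 0" "\<epsilon> * m < r" using r m0 by (auto simp: \<epsilon>_def field_simps)
    obtain \<delta> where \<delta>: "\<delta> > 0" "\<And>a b. a \<in> {t0 - e..t0 + e} \<times> K \<Longrightarrow> b \<in> {t0 - e..t0 + e} \<times> K \<Longrightarrow>
        dist b a < \<delta> \<Longrightarrow> dist (case b of (t, q) \<Rightarrow> f' t q) (case a of (t, q) \<Rightarrow> f' t q) < \<epsilon>"
      using uc \<epsilon>(1) unfolding uniformly_continuous_on_def by metis
    have "norm ((integral K (f (t0 + h)) - integral K (f t0)) / h - integral K (f' t0)) < r"
      if h: "h \<noteq> 0" "norm h < min \<delta> e" for h
    proof -
      have q: "norm ((f (t0 + h) q - f t0 q) / h - f' t0 q) \<le> \<epsilon>" if "q \<in> K" for q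
      proof -
        have "\<exists>s. \<bar>s\<bar> \<le> \<bar>h\<bar> \<and> f (t0 + h) q - f t0 q = h * f' (t0 + s) q"
        proof (cases "h > 0")
          case True
          then obtain s where "t0 < s" "s < t0 + h" "f (t0 + h) q - f t0 q = (t0 + h - t0) * f' s q"
            using MVT2[of t0 "t0 + h" "\<lambda>t. f t q" "\<lambda>t. f' t q"] d \<open>q \<in> K\<close> h by auto
          then show ?thesis by (intro exI[of _ "s - t0"]) auto
        next
          case False
          then obtain s where "t0 + h < s" "s < t0" "f t0 q - f (t0 + h) q = (t0 - (t0 + h)) * f' s q"
            using MVT2[of "t0 + h" t0 "\<lambda>t. f t q" "\<lambda>t. f' t q"] d \<open>q \<in> K\<close> h by auto
          then show ?thesis by (intro exI[of _ "s - t0"]) auto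
        qed
        then obtain s where s: "\<bar>s\<bar> \<le> \<bar>h\<bar>" "f (t0 + h) q - f t0 q = h * f' (t0 + s) q" by blast
        have "dist (f' (t0 + s) q) (f' t0 q) < \<epsilon>"
          using \<delta>(2)[of "(t0, q)" "(t0 + s, q)"] s h e \<open>q \<in> K\<close>
          by (force simp: dist_Pair_Pair dist_real_def)
        then show ?thesis using s h by (simp add: dist_real_def)
      qed
      have ch: "continuous_on K (f (t0 + h))" "continuous_on K (f t0)" using h e by (auto intro!: cf)
      note ii = integrable_on_compact[OF K]
      have ic: "(\<lambda>q. (f (t0 + h) q - f t0 q) / h) integrable_on K"
        "(\<lambda>q. (f (t0 + h) q - f t0 q) / h - f' t0 q) integrable_on K"
        using h by (auto intro!: ii continuous_intros ch c0)
      have "(integral K (f (t0 + h)) - integral K (f t0)) / h - integral K (f' t0)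
         = integral K (\<lambda>q. (f (t0 + h) q - f t0 q) / h - f' t0 q)"
        using ii[OF ch(1)] ii[OF ch(2)] ii[OF c0] ic(1) by (simp add: integral_diff)
      also have "norm \<dots> \<le> integral K (\<lambda>q. \<epsilon>)"
        using q by (intro integral_norm_bound_integral ic ii continuous_intros) auto
      finally show ?thesis using m[of \<epsilon>] \<epsilon> by simp
    qed
    then show "\<exists>s>0. \<forall>x. x \<noteq> 0 \<and> norm (x - 0) < s \<longrightarrow>
         norm ((integral K (f (t0 + x)) - integral K (f t0)) / x - integral K (f' t0)) < r"
      using \<delta>(1) e by (intro exI[of _ "min \<delta> e"]) auto
  qed
qed

lemma continuous_nonneg_integral_Dset_0:
  assumes c: "continuous_on Dset f" and nn: "\<And>q. q \<in> Dset \<Longrightarrow> f q \<ge> (0::real)"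
    and i: "integral Dset f = 0" and q: "q \<in> Dset"
  shows "f q = 0"
proof -
  have "closure (ball (0::real\<times>real) 1) = Dset" by (simp add: Dset_eq_cball)
  moreover have "emeasure lborel (cball (0::real\<times>real) 1) = emeasure lborel (ball (0::real\<times>real) 1)"
    "emeasure lborel (ball (0::real\<times>real) 1) < \<infinity>" "0 < emeasure lborel (ball (0::real\<times>real) 1)"
    by (simp_all add: emeasure_cball emeasure_ball)
  ultimately show ?thesis
    using assms integrable_on_compact[OF compact_Dset c]
    by (intro has_integral_0_closure_imp_0[of "ball 0 1" f q])
      (auto simp: has_integral_iff Dset_eq_cball)
qed

lemma indicator_Dset_slice:
  assumes "y\<^sup>2 \<le> 1"
  shows "inD x y \<longleftrightarrow> x \<in> {- sqrt (1 - y\<^sup>2)..sqrt (1 - y\<^sup>2)}"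
proof -
  have "inD x y \<longleftrightarrow> x\<^sup>2 \<le> (sqrt (1 - y\<^sup>2))\<^sup>2" using assms by (auto simp: inD_def)
  also have "\<dots> \<longleftrightarrow> \<bar>x\<bar> \<le> \<bar>sqrt (1 - y\<^sup>2)\<bar>" by (rule abs_le_square_iff[symmetric])
  finally show ?thesis using assms by (auto simp: abs_le_iff)
qed

lemma slice_integral_0:
  assumes d: "\<And>x. ((\<lambda>t. F t) has_real_derivative F' x) (at x)" and c: "continuous_on UNIV F'"
    and F: "\<And>x. x\<^sup>2 + y\<^sup>2 = 1 \<Longrightarrow> F x = 0"
  shows "(\<integral>x. (if inD x y then F' x else 0) \<partial>lborel) = 0"
proof (cases "y\<^sup>2 \<le> 1")
  case True
  define s where "s = sqrt (1 - y\<^sup>2)"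
  have s: "s \<ge> 0" "s\<^sup>2 + y\<^sup>2 = 1" using True by (auto simp: s_def)
  have "(\<lambda>x. if inD x y then F' x else 0) = (\<lambda>x. F' x * indicator {-s..s} x)"
    using indicator_Dset_slice[OF True] by (auto simp: s_def fun_eq_iff)
  moreover have "(\<integral>x. F' x * indicator {-s..s} x \<partial>lborel) = F s - F (-s)"
    using s c by (intro integral_FTC_Icc_real d) (auto simp: continuous_on_eq_continuous_at)
  ultimately show ?thesis using F[of s] F[of "-s"] s by simp
next
  case False
  then have "\<not> inD x y" for x
    using zero_le_power2[of x] unfolding inD_def by linarith
  then show ?thesis by simp
qed

lemma smooth3_continuous_on_slice:
  "smooth3 f \<Longrightarrow> continuous_on S (\<lambda>q. f z (fst q) (snd q))"
  by (rule cont3_continuous_on[OF smooth3_imp_cont3]) (auto intro!: continuous_intros)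

lemma smooth3_has_real_derivative:
  fixes f :: "real efun"
  assumes "smooth3 f"
  shows "((\<lambda>t. f t x y) has_real_derivative pz f z x y) (at z)"
    "((\<lambda>t. f z t y) has_real_derivative px f z x y) (at x)"
    "((\<lambda>t. f z x t) has_real_derivative py f z x y) (at y)"
  using smooth3_has_pdir[OF assms, of 0 z x y] smooth3_has_pdir[OF assms, of 1 z x y]
    smooth3_has_pdir[OF assms, of 2 z x y]
  by (simp_all add: has_pdir_def pdir_simps has_real_derivative_iff_has_vector_derivative)

lemma integral_Dset_lborel:
  fixes f :: "real \<Rightarrow> real \<Rightarrow> real"
  assumes "continuous_on UNIV (\<lambda>q. f (fst q) (snd q))"
  shows "integrable (lborel \<Otimes>\<^sub>M lborel) (\<lambda>(x, y). if inD x y then f x y else 0)"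
    and "integral Dset (\<lambda>q. f (fst q) (snd q))
      = integral\<^sup>L (lborel \<Otimes>\<^sub>M lborel) (\<lambda>(x, y). if inD x y then f x y else 0)"
proof -
  let ?g = "\<lambda>q. f (fst q) (snd q)"
  have e: "(\<lambda>q. indicator Dset q *\<^sub>R ?g q) = (\<lambda>(x, y). if inD x y then f x y else 0)"
    by (auto simp: fun_eq_iff Dset_def)
  have i: "integrable lborel (\<lambda>q. indicator Dset q *\<^sub>R ?g q)"
    by (rule borel_integrable_compact[OF compact_Dset continuous_on_subset[OF assms]]) simp
  then show "integrable (lborel \<Otimes>\<^sub>M lborel) (\<lambda>(x, y). if inD x y then f x y else 0)"
    unfolding e lborel_prod .
  show "integral Dset ?g
      = integral\<^sup>L (lborel \<Otimes>\<^sub>M lborel) (\<lambda>(x, y). if inD x y then f x y else 0)"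
    using set_borel_integral_eq_integral(2)[of Dset ?g] i
    unfolding set_integrable_def set_lebesgue_integral_def e lborel_prod by simp
qed

lemma integral_px_zero_boundary:
  fixes W :: "real efun"
  assumes W: "smooth3 W" and b: "\<And>x y. onbd x y \<Longrightarrow> W z x y = 0"
  shows "integral Dset (\<lambda>q. px W z (fst q) (snd q)) = 0"
proof -
  have c: "continuous_on UNIV (\<lambda>q. px W z (fst q) (snd q))"
    by (rule smooth3_continuous_on_slice[OF smooth3_px[OF W]])
  have "continuous_on UNIV (\<lambda>x. px W z x y)" for y
    by (rule cont3_continuous_on[OF smooth3_imp_cont3[OF smooth3_px[OF W]]]) (auto intro!: continuous_intros)
  then have "(\<integral>x. (if inD x y then px W z x y else 0) \<partial>lborel) = 0" for y
    by (intro slice_integral_0[of "\<lambda>x. W z x y"] smooth3_has_real_derivative W)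
      (auto simp: b onbd_def)
  then show ?thesis
    using lborel_pair.integral_snd[OF integral_Dset_lborel(1)[OF c]]
    by (simp add: integral_Dset_lborel(2)[OF c])
qed

lemma integral_py_zero_boundary:
  fixes W :: "real efun"
  assumes W: "smooth3 W" and b: "\<And>x y. onbd x y \<Longrightarrow> W z x y = 0"
  shows "integral Dset (\<lambda>q. py W z (fst q) (snd q)) = 0"
proof -
  have c: "continuous_on UNIV (\<lambda>q. py W z (fst q) (snd q))"
    by (rule smooth3_continuous_on_slice[OF smooth3_py[OF W]])
  have "continuous_on UNIV (\<lambda>y. py W z x y)" for x
    by (rule cont3_continuous_on[OF smooth3_imp_cont3[OF smooth3_py[OF W]]]) (auto intro!: continuous_intros)
  then have "(\<integral>y. (if inD y x then py W z x y else 0) \<partial>lborel) = 0" for x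
    by (intro slice_integral_0[of "\<lambda>y. W z x y"] smooth3_has_real_derivative W)
      (auto simp: b onbd_def add.commute)
  moreover have sym: "inD x y = inD y x" for x y by (simp add: inD_def add.commute)
  ultimately have "(\<integral>y. (if inD x y then py W z x y else 0) \<partial>lborel) = 0" for x
    by (subst sym) blast
  then show ?thesis
    using lborel_pair.integral_fst[OF integral_Dset_lborel(1)[OF c]]
    by (simp add: integral_Dset_lborel(2)[OF c])
qed

lemma power_times_one_minus_le:
  fixes t :: real
  assumes "0 \<le> t" "t \<le> 1"
  shows "real (Suc k) * t ^ k * (1 - t) \<le> 1"
proof -
  have "real (Suc k) * t ^ k = (\<Sum>i<Suc k. t ^ k)" by simp
  also have "\<dots> \<le> (\<Sum>i<Suc k. t ^ i)"
    using assms by (intro sum_mono power_decreasing) auto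
  finally have "real (Suc k) * t ^ k * (1 - t) \<le> (\<Sum>i<Suc k. t ^ i) * (1 - t)"
    using assms by (intro mult_right_mono) auto
  also have "\<dots> = 1 - t ^ Suc k" using one_diff_power_eq[of t "Suc k"] by (simp add: mult.commute)
  also have "\<dots> \<le> 1" using assms by simp
  finally show ?thesis .
qed

lemma boundary_zero_bound:
  fixes g :: "real efun"
  assumes g: "smooth3 g" and b: "\<And>x y. onbd x y \<Longrightarrow> g z x y = 0"
  obtains C where "C \<ge> 0" "\<And>x y. inD x y \<Longrightarrow> \<bar>g z x y\<bar> \<le> C * (1 - (x\<^sup>2 + y\<^sup>2))"
proof -
  let ?Q = "{-1..1} \<times> {-1..1} :: (real \<times> real) set"
  have Q: "compact ?Q" by (intro compact_Times compact_Icc)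
  have "bounded ((\<lambda>q. px g z (fst q) (snd q)) ` ?Q)" "bounded ((\<lambda>q. py g z (fst q) (snd q)) ` ?Q)"
    by (intro compact_imp_bounded compact_continuous_image Q smooth3_continuous_on_slice smooth3_px smooth3_py g)+
  then obtain A B where AB: "\<And>q. q \<in> ?Q \<Longrightarrow> \<bar>px g z (fst q) (snd q)\<bar> \<le> A"
      "\<And>q. q \<in> ?Q \<Longrightarrow> \<bar>py g z (fst q) (snd q)\<bar> \<le> B" unfolding bounded_iff by fastforce
  define M where "M = max A B"
  have M: "\<bar>px g z x y\<bar> \<le> M" "\<bar>py g z x y\<bar> \<le> M" if "\<bar>x\<bar> \<le> 1" "\<bar>y\<bar> \<le> 1" for x y
    using AB[of "(x, y)"] that by (auto simp: M_def abs_le_iff)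
  have M0: "M \<ge> 0" using M(1)[of 0 0] by simp
  have lip: "\<bar>g z x y - g z x' y'\<bar> \<le> M * \<bar>x - x'\<bar> + M * \<bar>y - y'\<bar>"
    if "\<bar>x\<bar> \<le> 1" "\<bar>y\<bar> \<le> 1" "\<bar>x'\<bar> \<le> 1" "\<bar>y'\<bar> \<le> 1" for x y x' y'
  proof -
    have "norm (g z x y - g z x' y) \<le> M * norm (x - x')"
      by (rule field_differentiable_bound[of "{-1..1}" "\<lambda>t. g z t y" "\<lambda>t. px g z t y"])
        (use that M(1) in \<open>auto intro!: has_field_derivative_at_within[OF smooth3_has_real_derivative(2)] g
          simp: abs_le_iff\<close>)
    moreover have "norm (g z x' y - g z x' y') \<le> M * norm (y - y')"
      by (rule field_differentiable_bound[of "{-1..1}" "\<lambda>t. g z x' t" "\<lambda>t. py g z x' t"])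
        (use that M(2) in \<open>auto intro!: has_field_derivative_at_within[OF smooth3_has_real_derivative(3)] g
          simp: abs_le_iff\<close>)
    ultimately show ?thesis by simp
  qed
  have "\<bar>g z x y\<bar> \<le> 2 * M * (1 - (x\<^sup>2 + y\<^sup>2))" if D: "inD x y" for x y
  proof (cases "x\<^sup>2 + y\<^sup>2 = 0")
    case True
    then have "x = 0" "y = 0" by (auto simp: sum_power2_eq_zero_iff)
    then show ?thesis using lip[of 0 0 1 0] b[of 1 0] M0 by (simp add: onbd_def)
  next
    case False
    define r where "r = sqrt (x\<^sup>2 + y\<^sup>2)"
    have r: "r > 0" "r\<^sup>2 = x\<^sup>2 + y\<^sup>2" "r \<le> 1"
      using False D sum_power2_ge_zero[of x y] by (auto simp: r_def inD_def order_less_le)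
    have xr: "\<bar>x\<bar> \<le> r" "\<bar>y\<bar> \<le> r" by (auto simp: r_def intro!: real_le_rsqrt)
    have bd: "onbd (x / r) (y / r)"
      using r False by (simp add: onbd_def power_divide add_divide_distrib[symmetric])
    have e: "\<bar>u - u / r\<bar> \<le> 1 - r" if "\<bar>u\<bar> \<le> r" for u
    proof -
      have "u - u / r = - (u / r) * (1 - r)" using r by (simp add: field_simps)
      then have "\<bar>u - u / r\<bar> = \<bar>u / r\<bar> * (1 - r)" using r by (simp add: abs_mult)
      also have "\<dots> \<le> 1 * (1 - r)" using r that by (intro mult_right_mono) auto
      finally show ?thesis by simp
    qed
    have "\<bar>g z x y - g z (x / r) (y / r)\<bar> \<le> M * \<bar>x - x / r\<bar> + M * \<bar>y - y / r\<bar>"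
      using xr r by (intro lip) auto
    also have "\<dots> \<le> M * (1 - r) + M * (1 - r)"
      using e xr M0 by (intro add_mono mult_left_mono) auto
    also have "\<dots> \<le> 2 * M * (1 - (x\<^sup>2 + y\<^sup>2))"
    proof -
      have "x\<^sup>2 + y\<^sup>2 \<le> r" using r by (metis power2_eq_square mult_left_le less_imp_le)
      then show ?thesis using mult_left_mono[OF _ M0, of "x\<^sup>2 + y\<^sup>2" r] by (simp add: algebra_simps)
    qed
    finally show ?thesis using b[OF bd] by simp
  qed
  then show ?thesis using that[of "2 * M"] M0 by auto
qed

lemma tendsto_power_mult_0:
  fixes t :: real
  assumes "0 \<le> t" "t < 1"
  shows "(\<lambda>k. real (Suc k) * t ^ k) \<longlonglongrightarrow> 0"
proof -
  have "(\<lambda>k. real k * t ^ k + t ^ k) \<longlonglongrightarrow> 0 + 0"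
    using assms by (intro tendsto_add powser_times_n_limit_0 LIMSEQ_realpow_zero) auto
  then show ?thesis by (simp add: algebra_simps)
qed

text \<open>Both sides of \<open>\<integral> (1 - r\<^sup>2\<^sup>k) div V = \<integral> 2k r\<^sup>2\<^sup>k\<^sup>-\<^sup>2 (x V\<^sub>1 + y V\<^sub>2)\<close> converge as \<open>k \<rightarrow> \<infinity>\<close>; the right one
  tends to \<open>0\<close> because \<open>x V\<^sub>1 + y V\<^sub>2 = O(1 - r\<^sup>2)\<close> and \<open>k t\<^sup>k\<^sup>-\<^sup>1 (1 - t) \<le> 1\<close>.\<close>

lemma integral_divergence_tangent:
  fixes V1 V2 :: "real efun"
  assumes V: "smooth3 V1" "smooth3 V2"
    and b: "\<And>x y. onbd x y \<Longrightarrow> x * V1 z x y + y * V2 z x y = 0"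
  shows "integral Dset (\<lambda>q. px V1 z (fst q) (snd q) + py V2 z (fst q) (snd q)) = 0"
proof -
  define g where "g z x y = x * V1 z x y + y * V2 z x y" for z x y
  have g: "smooth3 g" unfolding g_def by (intro smooth3_add smooth3_mult smooth3_x smooth3_y V)
  obtain C where C: "C \<ge> 0" "\<And>x y. inD x y \<Longrightarrow> \<bar>g z x y\<bar> \<le> C * (1 - (x\<^sup>2 + y\<^sup>2))"
    using boundary_zero_bound[OF g, of z] b by (auto simp: g_def)
  define dv where "dv q = px V1 z (fst q) (snd q) + py V2 z (fst q) (snd q)" for q
  have cdv: "continuous_on Dset dv"
    unfolding dv_def by (intro continuous_on_add smooth3_continuous_on_slice smooth3_px smooth3_py V)
  define R where "R q = (fst q)\<^sup>2 + (snd q)\<^sup>2" for q :: "real \<times> real"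
  have R: "0 \<le> R q" "R q \<le> 1" if "q \<in> Dset" for q using that by (auto simp: R_def Dset_def inD_def)
  define a where "a k q = (1 - R q ^ Suc k) * dv q - 2 * (real (Suc k) * R q ^ k) * g z (fst q) (snd q)" for k q
  define P :: "nat \<Rightarrow> real efun" where "P k = (\<lambda>z x y. 1 - (x\<^sup>2 + y\<^sup>2) ^ Suc k)" for k
  have P: "smooth3 (P k)" for k
    unfolding P_def by (intro smooth3_diff smooth3_const smooth3_power smooth3_add smooth3_x smooth3_y)
  have Pd: "has_pdir 1 (P k) z x y (- (real (Suc k) * (x\<^sup>2 + y\<^sup>2) ^ k * (2 * x)))"
    "has_pdir 2 (P k) z x y (- (real (Suc k) * (x\<^sup>2 + y\<^sup>2) ^ k * (2 * y)))" for k z x y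
    unfolding has_pdir_def P_def
    by (auto simp: has_real_derivative_iff_has_vector_derivative[symmetric] simp del: power_Suc
        intro!: derivative_eq_intros)
  have ia: "integral Dset (a k) = 0" for k
  proof -
    let ?W1 = "\<lambda>z x y. P k z x y * V1 z x y" and ?W2 = "\<lambda>z x y. P k z x y * V2 z x y"
    have W: "smooth3 ?W1" "smooth3 ?W2" by (intro smooth3_mult P V)+
    have W1: "px ?W1 z x y = P k z x y * px V1 z x y + - (real (Suc k) * (x\<^sup>2 + y\<^sup>2) ^ k * (2 * x)) * V1 z x y" for x y
      using has_pdir_imp_pdir[OF has_pdir_mult[OF Pd(1) smooth3_has_pdir[OF V(1)]]] by (simp add: pdir_simps)
    have W2: "py ?W2 z x y = P k z x y * py V2 z x y + - (real (Suc k) * (x\<^sup>2 + y\<^sup>2) ^ k * (2 * y)) * V2 z x y" for x y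
      using has_pdir_imp_pdir[OF has_pdir_mult[OF Pd(2) smooth3_has_pdir[OF V(2)]]] by (simp add: pdir_simps)
    have "integral Dset (\<lambda>q. px ?W1 z (fst q) (snd q)) + integral Dset (\<lambda>q. py ?W2 z (fst q) (snd q)) = 0"
      using integral_px_zero_boundary[OF W(1), of z] integral_py_zero_boundary[OF W(2), of z]
      by (simp add: P_def onbd_def)
    also have "integral Dset (\<lambda>q. px ?W1 z (fst q) (snd q)) + integral Dset (\<lambda>q. py ?W2 z (fst q) (snd q))
       = integral Dset (\<lambda>q. px ?W1 z (fst q) (snd q) + py ?W2 z (fst q) (snd q))"
      by (intro integral_add[symmetric] integrable_on_compact compact_Dset smooth3_continuous_on_slice
          smooth3_px smooth3_py W)
    also have "(\<lambda>q. px ?W1 z (fst q) (snd q) + py ?W2 z (fst q) (snd q)) = a k"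
      unfolding W1 W2 by (auto simp: a_def P_def g_def dv_def R_def fun_eq_iff algebra_simps)
    finally show ?thesis by simp
  qed
  have ca: "continuous_on Dset (a k)" for k
    unfolding a_def R_def
    by (intro continuous_intros cdv smooth3_continuous_on_slice g)
  have bound: "norm (a k q) \<le> \<bar>dv q\<bar> + 2 * C" if q: "q \<in> Dset" for k q
  proof -
    have "\<bar>g z (fst q) (snd q)\<bar> \<le> C * (1 - R q)" using C(2) q by (auto simp: Dset_def R_def)
    then have "real (Suc k) * R q ^ k * \<bar>g z (fst q) (snd q)\<bar> \<le> real (Suc k) * R q ^ k * (C * (1 - R q))"
      using R[OF q] by (intro mult_left_mono) auto
    also have "\<dots> = C * (real (Suc k) * R q ^ k * (1 - R q))" by (simp add: algebra_simps)
    also have "\<dots> \<le> C * 1"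
      by (rule mult_left_mono[OF power_times_one_minus_le[OF R[OF q]] C(1)])
    finally have 1: "real (Suc k) * R q ^ k * \<bar>g z (fst q) (snd q)\<bar> \<le> C" by simp
    have "\<bar>1 - R q ^ Suc k\<bar> \<le> 1"
      using R[OF q] power_le_one[OF R[OF q], of "Suc k"] zero_le_power[OF R(1)[OF q], of "Suc k"] by linarith
    then have 2: "\<bar>1 - R q ^ Suc k\<bar> * \<bar>dv q\<bar> \<le> \<bar>dv q\<bar>" by (simp add: mult_left_le_one_le)
    have "norm (a k q) \<le> \<bar>(1 - R q ^ Suc k) * dv q\<bar> + \<bar>2 * (real (Suc k) * R q ^ k) * g z (fst q) (snd q)\<bar>"
      unfolding a_def real_norm_def by (rule abs_triangle_ineq4)
    also have "\<dots> = \<bar>1 - R q ^ Suc k\<bar> * \<bar>dv q\<bar> + 2 * (real (Suc k) * R q ^ k * \<bar>g z (fst q) (snd q)\<bar>)"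
      using R[OF q] by (simp add: abs_mult del: of_nat_Suc power_Suc)
    finally show ?thesis using 1 2 by linarith
  qed
  define h where "h q = (if R q < 1 then dv q else 0)" for q
  have lim: "(\<lambda>k. a k q) \<longlonglongrightarrow> h q" if q: "q \<in> Dset" for q
  proof (cases "R q < 1")
    case True
    have "(\<lambda>k. a k q) \<longlonglongrightarrow> (1 - 0) * dv q - 2 * 0 * g z (fst q) (snd q)"
      unfolding a_def using R[OF q] True
      by (intro tendsto_intros tendsto_power_mult_0 LIMSEQ_Suc[OF LIMSEQ_realpow_zero]) auto
    then show ?thesis using True by (simp add: h_def)
  next
    case False
    then have "R q = 1" using R[OF q] by auto
    moreover then have "g z (fst q) (snd q) = 0" using b[of "fst q" "snd q"] by (simp add: g_def R_def onbd_def)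
    ultimately show ?thesis by (simp add: a_def h_def)
  qed
  have "(\<lambda>k. integral Dset (a k)) \<longlonglongrightarrow> integral Dset h"
    by (rule dominated_convergence(2)[of _ _ "\<lambda>q. \<bar>dv q\<bar> + 2 * C"])
      (use bound in \<open>auto intro!: integrable_on_compact compact_Dset ca continuous_intros cdv lim\<close>)
  then have "integral Dset h = 0" using LIMSEQ_unique[of "\<lambda>k. 0::real"] by (simp add: ia)
  moreover have "integral Dset h = integral Dset dv"
  proof (rule integral_spike[OF negligible_sphere[of 0 1]])
    fix q assume q: "q \<in> Dset - sphere 0 1"
    then have "R q \<noteq> 1" by (cases q) (auto simp: R_def norm_Pair)
    then show "dv q = h q" using R(2)[of q] q by (simp add: h_def)
  qed
  ultimately show ?thesis by (simp add: dv_def[abs_def])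
qed

lemma smooth3_agree_on_disc_imp_derivs_agree:
  fixes f g :: "real efun"
  assumes f: "smooth3 f" and g: "smooth3 g" and e: "\<And>x y. inD x y \<Longrightarrow> f z x y = g z x y" and D: "inD x y"
  shows "px f z x y = px g z x y" "py f z x y = py g z x y"
proof -
  have o: "open {x. x\<^sup>2 + y\<^sup>2 < (1::real)}" "open {x. y\<^sup>2 + x\<^sup>2 < (1::real)}" for y
    by (auto intro!: open_Collect_less continuous_intros)
  have ix: "px f z x y = px g z x y" if "x\<^sup>2 + y\<^sup>2 < 1" for x y
    using has_field_derivative_transform_within_open[OF smooth3_has_real_derivative(2)[OF f, of z y x] o(1)[of y],
        of "\<lambda>t. g z t y"] that e smooth3_has_real_derivative(2)[OF g, of z y x]
    by (auto simp: inD_def intro: DERIV_unique)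
  have iy: "py f z x y = py g z x y" if "x\<^sup>2 + y\<^sup>2 < 1" for x y
    using has_field_derivative_transform_within_open[OF smooth3_has_real_derivative(3)[OF f, of z x y] o(2)[of x],
        of "\<lambda>t. g z x t"] that e smooth3_has_real_derivative(3)[OF g, of z x y]
    by (auto simp: inD_def intro: DERIV_unique)
  have cl: "(x, y) \<in> closure (ball 0 1)" using D by (simp add: inD_def norm_Pair)
  have b: "(fst q)\<^sup>2 + (snd q)\<^sup>2 < 1" if "q \<in> ball 0 1" for q :: "real \<times> real"
    using that by (cases q) (simp add: norm_Pair)
  have "(\<lambda>q. px f z (fst q) (snd q) - px g z (fst q) (snd q)) (x, y) = 0"
    by (rule continuous_constant_on_closure[OF _ _ cl])
      (auto intro!: smooth3_continuous_on_slice smooth3_diff smooth3_px f g simp: ix b)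
  then show "px f z x y = px g z x y" by simp
  have "(\<lambda>q. py f z (fst q) (snd q) - py g z (fst q) (snd q)) (x, y) = 0"
    by (rule continuous_constant_on_closure[OF _ _ cl])
      (auto intro!: smooth3_continuous_on_slice smooth3_diff smooth3_py f g simp: iy b)
  then show "py f z x y = py g z x y" by simp
qed

subsection \<open>Functional derivatives and Hamilton's equations in strong form\<close>

lemma pz_mult: "smooth3 f \<Longrightarrow> smooth3 g \<Longrightarrow>
    pz (\<lambda>z x y. f z x y * g z x y) z x y = f z x y * pz g z x y + pz f z x y * (g z x y :: real)"
  and px_mult: "smooth3 f \<Longrightarrow> smooth3 g \<Longrightarrow>
    px (\<lambda>z x y. f z x y * g z x y) z x y = f z x y * px g z x y + px f z x y * (g z x y :: real)"
  and py_mult: "smooth3 f \<Longrightarrow> smooth3 g \<Longrightarrow>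
    py (\<lambda>z x y. f z x y * g z x y) z x y = f z x y * py g z x y + py f z x y * (g z x y :: real)"
  using has_pdir_imp_pdir[OF has_pdir_mult[OF smooth3_has_pdir smooth3_has_pdir], of f g 0]
    has_pdir_imp_pdir[OF has_pdir_mult[OF smooth3_has_pdir smooth3_has_pdir], of f g 1]
    has_pdir_imp_pdir[OF has_pdir_mult[OF smooth3_has_pdir smooth3_has_pdir], of f g 2]
  by (simp_all add: pdir_simps)

lemma px_add: "smooth3 f \<Longrightarrow> smooth3 g \<Longrightarrow>
    px (\<lambda>z x y. f z x y + g z x y) z x y = px f z x y + px g z x y"
  and py_add: "smooth3 f \<Longrightarrow> smooth3 g \<Longrightarrow>
    py (\<lambda>z x y. f z x y + g z x y) z x y = py f z x y + py g z x y"
  using has_pdir_imp_pdir[OF has_pdir_add[OF smooth3_has_pdir smooth3_has_pdir], of f g 1]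
    has_pdir_imp_pdir[OF has_pdir_add[OF smooth3_has_pdir smooth3_has_pdir], of f g 2]
  by (simp_all add: pdir_simps)

lemma dx2_slice: "smooth3 f \<Longrightarrow> dx2 (f z) x y = px f z x y"
  and dy2_slice: "smooth3 f \<Longrightarrow> dy2 (f z) x y = py f z x y"
  unfolding dx2_def dy2_def
  by (auto intro!: DERIV_imp_deriv smooth3_has_real_derivative)

lemma smooth2_continuous_on: "smooth2 f \<Longrightarrow> continuous_on S (\<lambda>q. f (fst q) (snd q))"
  unfolding smooth2_def using smooth3_continuous_on_slice[of "\<lambda>z. f"] by simp

lemma smooth2_add: "smooth2 f \<Longrightarrow> smooth2 g \<Longrightarrow> smooth2 (\<lambda>x y. f x y + g x y)"
  and smooth2_mult: "smooth2 f \<Longrightarrow> smooth2 g \<Longrightarrow> smooth2 (\<lambda>x y. f x y * g x y)"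
  and smooth2_const: "smooth2 (\<lambda>x y. c)"
  unfolding smooth2_def
  by (rule smooth3_add smooth3_mult smooth3_const; assumption)+

definition comp_smooth :: "pel \<Rightarrow> bool" where
  "comp_smooth X \<longleftrightarrow> smooth2 (pU1 X) \<and> smooth2 (pU2 X) \<and> smooth2 (pS X) \<and> smooth2 (pT X)"

lemma in_p_comp_smooth: "in_p X \<Longrightarrow> comp_smooth X"
  and in_pstar_comp_smooth: "in_pstar X \<Longrightarrow> comp_smooth X"
  by (auto simp: in_p_def in_pstar_def comp_smooth_def)

lemma pairing_integrable:
  assumes "comp_smooth A" "comp_smooth B"
  shows "(\<lambda>q. pU1 A (fst q) (snd q) * pU1 B (fst q) (snd q)
        + pU2 A (fst q) (snd q) * pU2 B (fst q) (snd q)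
        + pS A (fst q) (snd q) * pS B (fst q) (snd q)
        + pT A (fst q) (snd q) * pT B (fst q) (snd q)) integrable_on Dset"
  using assms unfolding comp_smooth_def
  by (intro integrable_on_compact compact_Dset continuous_on_add continuous_on_mult smooth2_continuous_on)
    auto

lemma pairing_padd_pscale:
  assumes "comp_smooth X" "comp_smooth Y" "comp_smooth A"
  shows "pairing (padd X (pscale l Y)) A = pairing X A + l * pairing Y A"
proof -
  have "pairing X A + l * pairing Y A = integral Dset (\<lambda>q. (pU1 X (fst q) (snd q) * pU1 A (fst q) (snd q)
        + pU2 X (fst q) (snd q) * pU2 A (fst q) (snd q)
        + pS X (fst q) (snd q) * pS A (fst q) (snd q)
        + pT X (fst q) (snd q) * pT A (fst q) (snd q)) +
       l * (pU1 Y (fst q) (snd q) * pU1 A (fst q) (snd q)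
        + pU2 Y (fst q) (snd q) * pU2 A (fst q) (snd q)
        + pS Y (fst q) (snd q) * pS A (fst q) (snd q)
        + pT Y (fst q) (snd q) * pT A (fst q) (snd q)))"
    unfolding pairing_def
    by (subst integral_add) (auto intro!: pairing_integrable integrable_on_mult_right assms)
  then show ?thesis
    unfolding pairing_def padd_def pscale_def
    by (simp add: algebra_simps)
qed

lemma comp_smooth_padd_pscale:
  "comp_smooth X \<Longrightarrow> comp_smooth Y \<Longrightarrow> comp_smooth (padd X (pscale l Y))"
  by (simp add: comp_smooth_def padd_def pscale_def smooth2_add smooth2_mult smooth2_const)

lemma pairing_cong:
  assumes "\<And>x y. inD x y \<Longrightarrow> pU1 X x y = pU1 X' x y \<and> pU2 X x y = pU2 X' x y \<and>
      pS X x y = pS X' x y \<and> pT X x y = pT X' x y"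
    and "\<And>x y. inD x y \<Longrightarrow> pU1 Y x y = pU1 Y' x y \<and> pU2 Y x y = pU2 Y' x y \<and>
      pS Y x y = pS Y' x y \<and> pT Y x y = pT Y' x y"
  shows "pairing X Y = pairing X' Y'"
  unfolding pairing_def using assms by (intro integral_cong) (simp add: Dset_def)

lemma sum_squares4_eq_0:
  fixes a b c d :: real
  shows "a * a + b * b + c * c + d * d = 0 \<longleftrightarrow> a = 0 \<and> b = 0 \<and> c = 0 \<and> d = 0"
  by (smt (verit) zero_le_square mult_eq_0_iff)

lemma pairing_self_eq_0:
  assumes X: "comp_smooth X" and 0: "pairing X X = 0" and D: "inD x y"
  shows "pU1 X x y = 0 \<and> pU2 X x y = 0 \<and> pS X x y = 0 \<and> pT X x y = 0"
proof -
  let ?f = "\<lambda>q. pU1 X (fst q) (snd q) * pU1 X (fst q) (snd q)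
        + pU2 X (fst q) (snd q) * pU2 X (fst q) (snd q)
        + pS X (fst q) (snd q) * pS X (fst q) (snd q)
        + pT X (fst q) (snd q) * pT X (fst q) (snd q)"
  have "continuous_on Dset ?f"
    using X unfolding comp_smooth_def
    by (intro continuous_on_add continuous_on_mult smooth2_continuous_on) auto
  then have "?f (x, y) = 0"
    using 0 D by (intro continuous_nonneg_integral_Dset_0[of ?f]) (auto simp: pairing_def Dset_def)
  then show ?thesis by (simp add: sum_squares4_eq_0)
qed

lemma is_fderiv_unique:
  assumes D1: "is_fderiv F X D1" and D2: "is_fderiv F X D2" and D: "inD x y"
  shows "pU1 D1 x y = pU1 D2 x y \<and> pU2 D1 x y = pU2 D2 x y \<and> pS D1 x y = pS D2 x y \<and> pT D1 x y = pT D2 x y"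
proof -
  let ?d = "padd D1 (pscale (-1) D2)"
  have c: "comp_smooth D1" "comp_smooth D2"
    using D1 D2 by (auto simp: is_fderiv_def in_p_comp_smooth)
  then have cd: "comp_smooth ?d" by (rule comp_smooth_padd_pscale)
  have "x * (a - b) + y * (c - d) = (x * a + y * c) - (x * b + y * d)" for x y a b c d :: real
    by (simp add: algebra_simps)
  then have "in_pstar ?d"
    using D1 D2 cd unfolding in_pstar_def comp_smooth_def is_fderiv_def in_p_def
    by (auto simp: padd_def pscale_def)
  then have "pairing ?d D1 = pairing ?d D2"
    using D1 D2 unfolding is_fderiv_def by (blast intro: DERIV_unique)
  moreover have "pairing A B = pairing B A" for A B by (simp add: pairing_def mult.commute)
  ultimately have "pairing ?d ?d = 0"
    using pairing_padd_pscale[OF c cd, of "-1"] by (metis add.right_inverse mult_minus1)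
  from pairing_self_eq_0[OF cd this D] show ?thesis by (simp add: padd_def pscale_def)
qed

lemma is_fderiv_pairing:
  assumes A: "in_p A" and X: "comp_smooth X"
  shows "is_fderiv (\<lambda>Y. pairing Y A) X A"
  unfolding is_fderiv_def
proof (intro conjI allI impI A)
  fix dX assume "in_pstar dX"
  then have "(\<lambda>l. pairing (padd X (pscale l dX)) A) = (\<lambda>l. pairing X A + l * pairing dX A)"
    using A X by (intro ext pairing_padd_pscale) (auto intro: in_p_comp_smooth in_pstar_comp_smooth)
  then show "((\<lambda>l. pairing (padd X (pscale l dX)) A) has_real_derivative pairing dX A) (at 0)"
    by (auto intro!: derivative_eq_intros)
qed

lemma smooth_curveD:
  assumes "smooth_curve Y"
  shows "smooth3 (\<lambda>z. pU1 (Y z))" "smooth3 (\<lambda>z. pU2 (Y z))" "smooth3 (\<lambda>z. pS (Y z))" "smooth3 (\<lambda>z. pT (Y z))"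
    "in_pstar (Y z)"
  using assms by (auto simp: smooth_curve_def)

lemma comp_smooth_dcurve:
  assumes "smooth_curve Y"
  shows "comp_smooth (dcurve Y z)"
  unfolding comp_smooth_def dcurve_def using smooth_curveD[OF assms]
  by (auto intro!: smooth2_slice smooth3_pz)

lemma has_derivative_pairing_curve:
  assumes Y: "smooth_curve Y" and A: "comp_smooth A"
  shows "((\<lambda>t. pairing (Y t) A) has_real_derivative pairing (dcurve Y z) A) (at z)"
proof -
  note sY = smooth_curveD[OF Y]
  have cp: "continuous_on S (\<lambda>p. f (fst p) (fst (snd p)) (snd (snd p)))" if "smooth3 f"
    for f :: "real efun" and S
    by (rule cont3_uncurry[OF smooth3_imp_cont3[OF that]])
  have cA: "continuous_on S (\<lambda>p. pU1 A (fst (snd p)) (snd (snd p)))"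
    "continuous_on S (\<lambda>p. pU2 A (fst (snd p)) (snd (snd p)))"
    "continuous_on S (\<lambda>p. pS A (fst (snd p)) (snd (snd p)))"
    "continuous_on S (\<lambda>p. pT A (fst (snd p)) (snd (snd p)))" for S :: "(real \<times> real \<times> real) set"
    using A cp[of "\<lambda>z. pU1 A"] cp[of "\<lambda>z. pU2 A"] cp[of "\<lambda>z. pS A"] cp[of "\<lambda>z. pT A"]
    by (auto simp: comp_smooth_def smooth2_def)
  show ?thesis
    unfolding pairing_def dcurve_def pel.simps
  proof (rule has_derivative_integral_compact[OF compact_Dset zero_less_one])
    fix t :: real
    show "continuous_on Dset (\<lambda>q. pU1 (Y t) (fst q) (snd q) * pU1 A (fst q) (snd q)
        + pU2 (Y t) (fst q) (snd q) * pU2 A (fst q) (snd q)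
        + pS (Y t) (fst q) (snd q) * pS A (fst q) (snd q)
        + pT (Y t) (fst q) (snd q) * pT A (fst q) (snd q))"
      using A in_pstar_comp_smooth[OF sY(5)] unfolding comp_smooth_def
      by (intro continuous_on_add continuous_on_mult smooth2_continuous_on) auto
  next
    fix t :: real and q :: "real \<times> real"
    show "((\<lambda>t. pU1 (Y t) (fst q) (snd q) * pU1 A (fst q) (snd q)
        + pU2 (Y t) (fst q) (snd q) * pU2 A (fst q) (snd q)
        + pS (Y t) (fst q) (snd q) * pS A (fst q) (snd q)
        + pT (Y t) (fst q) (snd q) * pT A (fst q) (snd q)) has_real_derivative
       pz (\<lambda>z. pU1 (Y z)) t (fst q) (snd q) * pU1 A (fst q) (snd q)
        + pz (\<lambda>z. pU2 (Y z)) t (fst q) (snd q) * pU2 A (fst q) (snd q)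
        + pz (\<lambda>z. pS (Y z)) t (fst q) (snd q) * pS A (fst q) (snd q)
        + pz (\<lambda>z. pT (Y z)) t (fst q) (snd q) * pT A (fst q) (snd q)) (at t)"
      by (intro DERIV_add DERIV_cmult_right smooth3_has_real_derivative(1)[OF sY(1)]
        smooth3_has_real_derivative(1)[OF sY(2)] smooth3_has_real_derivative(1)[OF sY(3)]
        smooth3_has_real_derivative(1)[OF sY(4)])
  next
    show "continuous_on ({z - 1..z + 1} \<times> Dset) (\<lambda>(t, q).
        pz (\<lambda>z. pU1 (Y z)) t (fst q) (snd q) * pU1 A (fst q) (snd q)
        + pz (\<lambda>z. pU2 (Y z)) t (fst q) (snd q) * pU2 A (fst q) (snd q)
        + pz (\<lambda>z. pS (Y z)) t (fst q) (snd q) * pS A (fst q) (snd q)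
        + pz (\<lambda>z. pT (Y z)) t (fst q) (snd q) * pT A (fst q) (snd q))"
      unfolding case_prod_unfold
      by (intro continuous_on_add continuous_on_mult cA cp[OF smooth3_pz[OF sY(1)]]
        cp[OF smooth3_pz[OF sY(2)]] cp[OF smooth3_pz[OF sY(3)]] cp[OF smooth3_pz[OF sY(4)]])
  qed
qed

lemma admissible_pairing: "in_p A \<Longrightarrow> admissible (\<lambda>Y. pairing Y A)"
  unfolding admissible_def
  by (intro allI impI exI[of _ A] conjI is_fderiv_pairing has_derivative_pairing_curve)
    (auto intro: in_p_comp_smooth in_pstar_comp_smooth smooth_curveD(5))

lemma dx2_cong_disc:
  assumes "smooth2 f" "smooth2 g" "\<And>x y. inD x y \<Longrightarrow> f x y = g x y" "inD x y"
  shows "dx2 f x y = dx2 g x y" "dy2 f x y = dy2 g x y"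
  using smooth3_agree_on_disc_imp_derivs_agree[of "\<lambda>z. f" "\<lambda>z. g", OF _ _ _ assms(4)] assms(1-3)
    dx2_slice[of "\<lambda>z. f"] dx2_slice[of "\<lambda>z. g"] dy2_slice[of "\<lambda>z. f"] dy2_slice[of "\<lambda>z. g"]
  by (auto simp: smooth2_def)

lemma hamilton_iff_weak:
  assumes X: "smooth_curve X" and D: "\<And>z. is_fderiv (H z) (X z) (D z)"
  shows "hamilton H X \<longleftrightarrow>
    (\<forall>z A. in_p A \<longrightarrow> pairing (dcurve X z) A = pairing (X z) (pbracket A (D z)))"
proof
  assume h: "hamilton H X"
  show "\<forall>z A. in_p A \<longrightarrow> pairing (dcurve X z) A = pairing (X z) (pbracket A (D z))"
  proof (intro allI impI)
    fix z A assume A: "in_p A"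
    obtain E where E: "is_fderiv (H z) (X z) E" and
      "\<forall>F DF. admissible F \<longrightarrow> is_fderiv F (X z) DF \<longrightarrow>
           ((\<lambda>t. F (X t)) has_real_derivative pairing (X z) (pbracket DF E)) (at z)"
      using h unfolding hamilton_def by metis
    then have "((\<lambda>t. pairing (X t) A) has_real_derivative pairing (X z) (pbracket A E)) (at z)"
      using admissible_pairing[OF A] is_fderiv_pairing[OF A in_pstar_comp_smooth[OF smooth_curveD(5)[OF X]]]
      by blast
    then have "pairing (dcurve X z) A = pairing (X z) (pbracket A E)"
      using has_derivative_pairing_curve[OF X in_p_comp_smooth[OF A]] DERIV_unique by blast
    also have "\<dots> = pairing (X z) (pbracket A (D z))"
    proof (rule pairing_cong)
      note u = is_fderiv_unique[OF E D[of z]]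
      have s: "comp_smooth E" "comp_smooth (D z)"
        using E D[of z] by (auto simp: is_fderiv_def in_p_comp_smooth)
      fix x y assume i: "inD x y"
      have e: "pU1 E x y = pU1 (D z) x y" "pU2 E x y = pU2 (D z) x y"
        using u[OF i] by auto
      have d: "dx2 (pU1 E) x y = dx2 (pU1 (D z)) x y" "dx2 (pU2 E) x y = dx2 (pU2 (D z)) x y"
        "dx2 (pS E) x y = dx2 (pS (D z)) x y" "dx2 (pT E) x y = dx2 (pT (D z)) x y"
        "dy2 (pU1 E) x y = dy2 (pU1 (D z)) x y" "dy2 (pU2 E) x y = dy2 (pU2 (D z)) x y"
        "dy2 (pS E) x y = dy2 (pS (D z)) x y" "dy2 (pT E) x y = dy2 (pT (D z)) x y"
        using s u i by (auto intro!: dx2_cong_disc simp: comp_smooth_def)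
      show "pU1 (pbracket A E) x y = pU1 (pbracket A (D z)) x y \<and>
         pU2 (pbracket A E) x y = pU2 (pbracket A (D z)) x y \<and>
         pS (pbracket A E) x y = pS (pbracket A (D z)) x y \<and>
         pT (pbracket A E) x y = pT (pbracket A (D z)) x y"
        by (simp add: pbracket_def lie_fun_def e d)
    qed auto
    finally show "pairing (dcurve X z) A = pairing (X z) (pbracket A (D z))" .
  qed
next
  assume w: "\<forall>z A. in_p A \<longrightarrow> pairing (dcurve X z) A = pairing (X z) (pbracket A (D z))"
  have "((\<lambda>t. F (X t)) has_real_derivative pairing (X z) (pbracket DF (D z))) (at z)"
    if F: "admissible F" "is_fderiv F (X z) DF" for z F DF
  proof -
    obtain E where E: "is_fderiv F (X z) E"
      "((\<lambda>t. F (X t)) has_real_derivative pairing (dcurve X z) E) (at z)"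
      using F(1) X unfolding admissible_def by blast
    have "pairing (dcurve X z) E = pairing (dcurve X z) DF"
      using is_fderiv_unique[OF E(1) F(2)] by (intro pairing_cong) auto
    also have "\<dots> = pairing (X z) (pbracket DF (D z))"
      using w F(2) by (simp add: is_fderiv_def)
    finally show ?thesis using E(2) by simp
  qed
  then show "hamilton H X" using X D unfolding hamilton_def by blast
qed

definition flux_div :: "real efun \<Rightarrow> real efun \<Rightarrow> real efun \<Rightarrow> real efun" where
  "flux_div f u v z x y = px (\<lambda>z x y. f z x y * u z x y) z x y + py (\<lambda>z x y. f z x y * v z x y) z x y"

lemma smooth3_flux_div:
  "smooth3 f \<Longrightarrow> smooth3 u \<Longrightarrow> smooth3 v \<Longrightarrow> smooth3 (flux_div f u v)"
  unfolding flux_div_def by (intro smooth3_add smooth3_px smooth3_py smooth3_mult)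

lemma flux_div_eq:
  assumes "smooth3 f" "smooth3 u" "smooth3 v"
  shows "flux_div f u v z x y = f z x y * px u z x y + px f z x y * u z x y
    + f z x y * py v z x y + py f z x y * v z x y"
  using assms by (simp add: flux_div_def px_mult py_mult)

lemma weak_iff_strong:
  fixes d1 d2 dS dT :: "real efun"
  assumes X: "smooth_curve X"
    and s: "smooth3 d1" "smooth3 d2" "smooth3 dS" "smooth3 dT"
    and D: "D = \<lparr>pU1 = d1 z, pU2 = d2 z, pS = dS z, pT = dT z\<rparr>"
    and tan: "\<forall>x y. onbd x y \<longrightarrow> x * d1 z x y + y * d2 z x y = 0"
  defines "R1 \<equiv> \<lambda>x y. pz (\<lambda>z. pU1 (X z)) z x y + flux_div (\<lambda>z. pU1 (X z)) d1 d2 z x y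
      + pU1 (X z) x y * px d1 z x y + pU2 (X z) x y * px d2 z x y
      + pS (X z) x y * px dS z x y + pT (X z) x y * px dT z x y"
    and "R2 \<equiv> \<lambda>x y. pz (\<lambda>z. pU2 (X z)) z x y + flux_div (\<lambda>z. pU2 (X z)) d1 d2 z x y
      + pU1 (X z) x y * py d1 z x y + pU2 (X z) x y * py d2 z x y
      + pS (X z) x y * py dS z x y + pT (X z) x y * py dT z x y"
    and "R3 \<equiv> \<lambda>x y. pz (\<lambda>z. pS (X z)) z x y + flux_div (\<lambda>z. pS (X z)) d1 d2 z x y"
    and "R4 \<equiv> \<lambda>x y. pz (\<lambda>z. pT (X z)) z x y + flux_div (\<lambda>z. pT (X z)) d1 d2 z x y"
  shows "(\<forall>A. in_p A \<longrightarrow> pairing (dcurve X z) A = pairing (X z) (pbracket A D)) \<longleftrightarrow>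
    (\<forall>x y. inD x y \<longrightarrow> R1 x y = 0 \<and> R2 x y = 0 \<and> R3 x y = 0 \<and> R4 x y = 0)"
proof -
  note sX = smooth_curveD(1-4)[OF X]
  define RR where "RR = \<lparr>pU1 = R1, pU2 = R2, pS = R3, pT = R4\<rparr>"
  have sRs: "smooth3 (\<lambda>z x y. pz (\<lambda>z. pU1 (X z)) z x y + flux_div (\<lambda>z. pU1 (X z)) d1 d2 z x y
      + pU1 (X z) x y * px d1 z x y + pU2 (X z) x y * px d2 z x y
      + pS (X z) x y * px dS z x y + pT (X z) x y * px dT z x y)"
    "smooth3 (\<lambda>z x y. pz (\<lambda>z. pU2 (X z)) z x y + flux_div (\<lambda>z. pU2 (X z)) d1 d2 z x y
      + pU1 (X z) x y * py d1 z x y + pU2 (X z) x y * py d2 z x y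
      + pS (X z) x y * py dS z x y + pT (X z) x y * py dT z x y)"
    "smooth3 (\<lambda>z x y. pz (\<lambda>z. pS (X z)) z x y + flux_div (\<lambda>z. pS (X z)) d1 d2 z x y)"
    "smooth3 (\<lambda>z x y. pz (\<lambda>z. pT (X z)) z x y + flux_div (\<lambda>z. pT (X z)) d1 d2 z x y)"
    by (intro smooth3_add smooth3_mult smooth3_flux_div smooth3_px smooth3_py smooth3_pz sX s)+
  have sR: "comp_smooth RR"
    using sRs[THEN smooth2_slice, of z] by (simp add: comp_smooth_def RR_def R1_def R2_def R3_def R4_def)
  have key: "pairing (dcurve X z) A - pairing (X z) (pbracket A D) = pairing RR A"
    if A: "comp_smooth A" for A
  proof -
    have sA: "smooth3 (\<lambda>z. pU1 A)" "smooth3 (\<lambda>z. pU2 A)" "smooth3 (\<lambda>z. pS A)" "smooth3 (\<lambda>z. pT A)"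
      using A by (auto simp: comp_smooth_def smooth2_def)
    define W where "W = (\<lambda>z x y. pU1 (X z) x y * pU1 A x y + pU2 (X z) x y * pU2 A x y
        + pS (X z) x y * pS A x y + pT (X z) x y * pT A x y)"
    have sW: "smooth3 W" unfolding W_def by (intro smooth3_add smooth3_mult sX sA)
    have dW: "px W z x y = pU1 (X z) x y * px (\<lambda>z. pU1 A) z x y + px (\<lambda>z. pU1 (X z)) z x y * pU1 A x y
        + (pU2 (X z) x y * px (\<lambda>z. pU2 A) z x y + px (\<lambda>z. pU2 (X z)) z x y * pU2 A x y)
        + (pS (X z) x y * px (\<lambda>z. pS A) z x y + px (\<lambda>z. pS (X z)) z x y * pS A x y)
        + (pT (X z) x y * px (\<lambda>z. pT A) z x y + px (\<lambda>z. pT (X z)) z x y * pT A x y)"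
      "py W z x y = pU1 (X z) x y * py (\<lambda>z. pU1 A) z x y + py (\<lambda>z. pU1 (X z)) z x y * pU1 A x y
        + (pU2 (X z) x y * py (\<lambda>z. pU2 A) z x y + py (\<lambda>z. pU2 (X z)) z x y * pU2 A x y)
        + (pS (X z) x y * py (\<lambda>z. pS A) z x y + py (\<lambda>z. pS (X z)) z x y * pS A x y)
        + (pT (X z) x y * py (\<lambda>z. pT A) z x y + py (\<lambda>z. pT (X z)) z x y * pT A x y)" for x y
      unfolding W_def
      by (simp_all add: px_add py_add px_mult[OF sX(1) sA(1)] px_mult[OF sX(2) sA(2)] px_mult[OF sX(3) sA(3)]
          px_mult[OF sX(4) sA(4)] py_mult[OF sX(1) sA(1)] py_mult[OF sX(2) sA(2)] py_mult[OF sX(3) sA(3)]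
          py_mult[OF sX(4) sA(4)] smooth3_add smooth3_mult sX sA)
    have bA: "dx2 (pU1 A) = px (\<lambda>z. pU1 A) z" "dx2 (pU2 A) = px (\<lambda>z. pU2 A) z"
      "dx2 (pS A) = px (\<lambda>z. pS A) z" "dx2 (pT A) = px (\<lambda>z. pT A) z"
      "dy2 (pU1 A) = py (\<lambda>z. pU1 A) z" "dy2 (pU2 A) = py (\<lambda>z. pU2 A) z"
      "dy2 (pS A) = py (\<lambda>z. pS A) z" "dy2 (pT A) = py (\<lambda>z. pT A) z"
      using dx2_slice[OF sA(1)] dx2_slice[OF sA(2)] dx2_slice[OF sA(3)] dx2_slice[OF sA(4)]
        dy2_slice[OF sA(1)] dy2_slice[OF sA(2)] dy2_slice[OF sA(3)] dy2_slice[OF sA(4)]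
      by (auto simp: fun_eq_iff)
    have bD: "dx2 (d1 z) = px d1 z" "dx2 (d2 z) = px d2 z" "dx2 (dS z) = px dS z" "dx2 (dT z) = px dT z"
      "dy2 (d1 z) = py d1 z" "dy2 (d2 z) = py d2 z" "dy2 (dS z) = py dS z" "dy2 (dT z) = py dT z"
      using s by (auto simp: fun_eq_iff dx2_slice dy2_slice)
    have br: "smooth3 (\<lambda>z x y. - (pU1 A x y * px f z x y + pU2 A x y * py f z x y
        - (d1 z x y * px g z x y + d2 z x y * py g z x y)))" if "smooth3 f" "smooth3 g" for f g
      by (intro smooth3_uminus smooth3_diff smooth3_add smooth3_mult smooth3_px smooth3_py s sA that)
    have smB: "comp_smooth (pbracket A D)"
      unfolding comp_smooth_def pbracket_def lie_fun_def D pel.simps bA bD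
      using br[THEN smooth2_slice, OF s(1) sA(1), of z] br[THEN smooth2_slice, OF s(2) sA(2), of z]
        br[THEN smooth2_slice, OF s(3) sA(3), of z] br[THEN smooth2_slice, OF s(4) sA(4), of z] by blast
    note fd = flux_div_eq[OF sX(1) s(1,2)] flux_div_eq[OF sX(2) s(1,2)] flux_div_eq[OF sX(3) s(1,2)]
      flux_div_eq[OF sX(4) s(1,2)] flux_div_eq[OF sW s(1,2)]
    have "x * (W z x y * d1 z x y) + y * (W z x y * d2 z x y) = 0" if "onbd x y" for x y
      using tan[rule_format, OF that] by (metis (no_types, opaque_lifting) mult.left_commute mult_zero_right distrib_left)
    then have "integral Dset (\<lambda>q. flux_div W d1 d2 z (fst q) (snd q)) = 0"
      unfolding flux_div_def using sW s by (intro integral_divergence_tangent) (auto intro: smooth3_mult)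
    then have "pairing (dcurve X z) A - pairing (X z) (pbracket A D) =
       pairing (dcurve X z) A - pairing (X z) (pbracket A D) + integral Dset (\<lambda>q. flux_div W d1 d2 z (fst q) (snd q))"
      by simp
    also have "\<dots> = pairing RR A"
      unfolding pairing_def
      apply (subst integral_diff[symmetric])
        apply (rule pairing_integrable[OF comp_smooth_dcurve[OF X] A])
       apply (rule pairing_integrable[OF in_pstar_comp_smooth[OF smooth_curveD(5)[OF X]] smB])
      apply (subst integral_add[symmetric])
        apply (rule integrable_diff)
         apply (rule pairing_integrable[OF comp_smooth_dcurve[OF X] A])
        apply (rule pairing_integrable[OF in_pstar_comp_smooth[OF smooth_curveD(5)[OF X]] smB])
       apply (intro integrable_on_compact compact_Dset smooth3_continuous_on_slice smooth3_flux_div sW s)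
      apply (rule integral_cong)
      unfolding RR_def R1_def R2_def R3_def R4_def D fd dW pbracket_def lie_fun_def dcurve_def pel.simps bA bD
      unfolding W_def
      apply (simp add: algebra_simps)
      done
    finally show ?thesis .
  qed
  show ?thesis
  proof
    assume w: "\<forall>A. in_p A \<longrightarrow> pairing (dcurve X z) A = pairing (X z) (pbracket A D)"
    show "\<forall>x y. inD x y \<longrightarrow> R1 x y = 0 \<and> R2 x y = 0 \<and> R3 x y = 0 \<and> R4 x y = 0"
    proof -
      define ph :: sfun where "ph x y = 1 - (x * x + y * y)" for x y
      have ph: "smooth2 ph"
        unfolding smooth2_def ph_def
        by (intro smooth3_diff smooth3_add smooth3_mult smooth3_const smooth3_x smooth3_y)
      define A where "A = \<lparr>pU1 = \<lambda>x y. ph x y * R1 x y, pU2 = \<lambda>x y. ph x y * R2 x y,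
         pS = \<lambda>x y. ph x y * R3 x y, pT = \<lambda>x y. ph x y * R4 x y\<rparr>"
      have cA: "comp_smooth A" using sR ph by (simp add: comp_smooth_def A_def RR_def smooth2_mult)
      then have "in_p A"
        unfolding in_p_def comp_smooth_def by (simp add: A_def ph_def onbd_def power2_eq_square)
      then have 0: "pairing RR A = 0" using w key[OF cA] by simp
      define Q where "Q q = R1 (fst q) (snd q) * R1 (fst q) (snd q) + R2 (fst q) (snd q) * R2 (fst q) (snd q)
         + R3 (fst q) (snd q) * R3 (fst q) (snd q) + R4 (fst q) (snd q) * R4 (fst q) (snd q)" for q
      have cQ: "continuous_on S Q" for S
        using sR unfolding Q_def comp_smooth_def RR_def
        by (intro continuous_on_add continuous_on_mult smooth2_continuous_on) auto
      have "ph (fst q) (snd q) * Q q = 0" if q: "q \<in> Dset" for q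
      proof (rule continuous_nonneg_integral_Dset_0[of "\<lambda>q. ph (fst q) (snd q) * Q q", OF _ _ _ q])
        show "continuous_on Dset (\<lambda>q. ph (fst q) (snd q) * Q q)"
          by (intro continuous_on_mult smooth2_continuous_on ph cQ)
        show "0 \<le> ph (fst q) (snd q) * Q q" if "q \<in> Dset" for q
          using that by (intro mult_nonneg_nonneg) (auto simp: ph_def Q_def Dset_def inD_def power2_eq_square)
        show "integral Dset (\<lambda>q. ph (fst q) (snd q) * Q q) = 0"
          using 0 by (simp add: pairing_def RR_def A_def Q_def algebra_simps)
      qed
      moreover have "ph (fst q) (snd q) \<noteq> 0" "q \<in> Dset" if "q \<in> ball 0 1" for q
        using that by (cases q; auto simp: ph_def norm_Pair power2_eq_square Dset_def inD_def)+
      ultimately have "Q q = 0" if "q \<in> ball 0 1" for q using that by (metis mult_eq_0_iff)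
      then have "Q q = 0" if "q \<in> closure (ball 0 1)" for q
        using continuous_constant_on_closure[OF cQ _ that] by blast
      then have "Q (x, y) = 0" if "inD x y" for x y
        using that by (simp add: inD_def norm_Pair)
      then show ?thesis by (simp add: Q_def sum_squares4_eq_0)
    qed
  next
    assume r: "\<forall>x y. inD x y \<longrightarrow> R1 x y = 0 \<and> R2 x y = 0 \<and> R3 x y = 0 \<and> R4 x y = 0"
    have "pairing RR A = 0" for A
      unfolding pairing_def RR_def using r
      by (intro integral_unique has_integral_is_0) (simp add: Dset_def)
    then show "\<forall>A. in_p A \<longrightarrow> pairing (dcurve X z) A = pairing (X z) (pbracket A D)"
      using key in_p_comp_smooth by fastforce
  qed
qed

subsection \<open>Geometry of the coordinates\<close>

lemma bounded_bilinear_cross3: "bounded_bilinear cross3"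
  using bilinear_cross bilinear_conv_bounded_bilinear by blast

lemma nonvanishing_reciprocal_nbhd:
  fixes a :: "real efun"
  assumes a: "smooth3 a" and c: "c > 0"
  obtains b G where "smooth3 b" "open G" "\<And>z x y. \<bar>a z x y\<bar> > c \<Longrightarrow> (z, x, y) \<in> G"
    "\<And>z x y. (z, x, y) \<in> G \<Longrightarrow> a z x y \<noteq> 0 \<and> b z x y = 1 / a z x y"
proof -
  obtain b where b: "smooth3 b" "\<And>z x y. \<bar>a z x y\<bar> > c \<Longrightarrow> b z x y = 1 / a z x y"
    using smooth3_reciprocal_extension[OF a c] by blast
  let ?G = "{q. c < \<bar>a (fst q) (fst (snd q)) (snd (snd q))\<bar>}"
  have "open ?G"
    by (intro open_Collect_less continuous_on_const continuous_on_rabs cont3_uncurry smooth3_imp_cont3 a)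
  then show ?thesis using that[of b ?G] b c by auto
qed

lemma nonvanishing_on_slice_reciprocal:
  fixes a :: "real efun"
  assumes a: "smooth3 a" and nz: "\<And>x y. inD x y \<Longrightarrow> a z x y \<noteq> 0"
  obtains b G where "smooth3 b" "open G" "\<And>x y. inD x y \<Longrightarrow> (z, x, y) \<in> G"
    "\<And>z x y. (z, x, y) \<in> G \<Longrightarrow> a z x y \<noteq> 0 \<and> b z x y = 1 / a z x y"
proof -
  have ne: "Dset \<noteq> {}" by (simp add: Dset_eq_cball)
  have "continuous_on Dset (\<lambda>q. \<bar>a z (fst q) (snd q)\<bar>)"
    by (intro continuous_on_rabs smooth3_continuous_on_slice a)
  from continuous_attains_inf[OF compact_Dset ne this]
  obtain m where m: "m \<in> Dset" "\<And>q. q \<in> Dset \<Longrightarrow> \<bar>a z (fst m) (snd m)\<bar> \<le> \<bar>a z (fst q) (snd q)\<bar>" by auto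
  define c where "c = \<bar>a z (fst m) (snd m)\<bar> / 2"
  have c: "c > 0" using m nz by (auto simp: c_def Dset_def)
  have "\<bar>a z x y\<bar> > c" if "inD x y" for x y using m(2)[of "(x, y)"] that c by (auto simp: c_def Dset_def)
  then show ?thesis using nonvanishing_reciprocal_nbhd[OF a c] that by metis
qed

lemma periodic_positive_reciprocal:
  fixes a :: "real efun"
  assumes a: "smooth3 a" and per: "\<And>z x y. a (z + 2 * pi) x y = a z x y"
    and pos: "\<And>z x y. inD x y \<Longrightarrow> a z x y > 0"
  obtains b G where "smooth3 b" "open G" "\<And>z x y. inD x y \<Longrightarrow> (z, x, y) \<in> G"
    "\<And>z x y. (z, x, y) \<in> G \<Longrightarrow> a z x y \<noteq> 0 \<and> b z x y = 1 / a z x y"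
proof -
  let ?K = "{0..2 * pi} \<times> Dset"
  have K: "compact ?K" "?K \<noteq> {}"
    by (intro compact_Times compact_Icc compact_Dset) (simp add: Dset_eq_cball)
  have "continuous_on ?K (\<lambda>q. a (fst q) (fst (snd q)) (snd (snd q)))"
    by (intro cont3_uncurry smooth3_imp_cont3 a)
  from continuous_attains_inf[OF K this] obtain m where m: "m \<in> ?K"
      "\<And>q. q \<in> ?K \<Longrightarrow> a (fst m) (fst (snd m)) (snd (snd m)) \<le> a (fst q) (fst (snd q)) (snd (snd q))"
    by blast
  define c where "c = a (fst m) (fst (snd m)) (snd (snd m)) / 2"
  have c: "c > 0" using m(1) pos by (auto simp: c_def Dset_def)
  have "\<bar>a z x y\<bar> > c" if D: "inD x y" for z x y
  proof -
    interpret periodic_fun_simple "\<lambda>z. a z x y" "2 * pi" by standard (rule per)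
    define k where "k = \<lfloor>z / (2 * pi)\<rfloor>"
    have "of_int k \<le> z / (2 * pi)" "z / (2 * pi) < of_int k + 1" unfolding k_def by linarith+
    then have "z - of_int k * (2 * pi) \<in> {0..2 * pi}" by (auto simp: field_simps)
    then have "2 * c \<le> a (z - of_int k * (2 * pi)) x y"
      using m(2)[of "(z - of_int k * (2 * pi), x, y)"] D by (simp add: c_def Dset_def)
    then show ?thesis using c minus_of_int[of z k] by simp
  qed
  then show ?thesis using nonvanishing_reciprocal_nbhd[OF a c] that by metis
qed

locale isothermal_torus =
  fixes Phi :: "(real^3) efun"
  assumes tor: "toroidal Phi" and bc: "boundary_compatible Phi" and iso: "isothermal Phi"
begin

lemma Phi_smooth: "smooth3 Phi"
  using tor by (simp add: toroidal_def)

lemma gc_smooth: "smooth3 (gc Phi i j)"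
  unfolding gc_def[abs_def]
  by (intro smooth3_bilinear[OF bounded_bilinear_inner] smooth3_pdir Phi_smooth)

lemma h_smooth: "smooth3 (hxx Phi)" "smooth3 (hxy Phi)" "smooth3 (hyy Phi)"
  by (simp_all add: hxx_def hxy_def hyy_def gc_smooth)

lemma hdet_smooth: "smooth3 (hdet Phi)"
  unfolding hdet_def[abs_def] by (intro smooth3_diff smooth3_mult smooth3_power h_smooth)

lemma omega_smooth: "smooth3 (omega Phi)"
  unfolding omega_def[abs_def]
  by (rule smooth3_bilinear[OF bounded_bilinear_inner smooth3_pz[OF Phi_smooth]
      smooth3_bilinear[OF bounded_bilinear_cross3 smooth3_px[OF Phi_smooth] smooth3_py[OF Phi_smooth]]])

lemma pdir_periodic: "pdir i Phi (z + 2 * pi) x y = pdir i Phi z x y"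
proof -
  have per: "Phi (z + 2 * pi) x y = Phi z x y" for z x y using tor by (simp add: toroidal_def)
  have "((\<lambda>t. Phi t x y) has_vector_derivative pz Phi (z + 2 * pi) x y) (at (z + 2 * pi))"
    using smooth3_has_pdir[OF Phi_smooth, of 0 "z + 2 * pi" x y] by (simp add: has_pdir_def pdir_simps)
  then have "((\<lambda>t. Phi t x y) \<circ> (\<lambda>t. t + 2 * pi) has_vector_derivative 1 *\<^sub>R pz Phi (z + 2 * pi) x y) (at z)"
    by (intro vector_diff_chain_at) (auto intro!: derivative_eq_intros)
  then have "((\<lambda>t. Phi t x y) has_vector_derivative pz Phi (z + 2 * pi) x y) (at z)"
    by (simp add: o_def per)
  then have "pz Phi (z + 2 * pi) x y = pz Phi z x y" by (simp add: pz_def vector_derivative_at)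
  then show ?thesis by (simp add: pdir_def px_def py_def per)
qed

lemma isothermalE:
  assumes "inD x y"
  obtains f where "f > 0" "hxx Phi z x y = f" "hyy Phi z x y = f" "hxy Phi z x y = 0"
proof -
  obtain f where "f \<noteq> 0" "hxx Phi z x y = f" "hyy Phi z x y = f" "hxy Phi z x y = 0"
    using iso assms unfolding isothermal_def by blast
  moreover have "hxx Phi z x y \<ge> 0" by (simp add: hxx_def gc_def)
  ultimately show ?thesis using that by auto
qed

lemma hdet_pos: "inD x y \<Longrightarrow> hdet Phi z x y > 0"
  by (rule isothermalE[of x y z]) (auto simp: hdet_def)

lemma omega_pos: "inD x y \<Longrightarrow> omega Phi z x y > 0"
  using tor by (auto simp: toroidal_def omega_def)

lemma shift_tangent:
  assumes b: "onbd x y"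
  shows "x * shiftx Phi z x y + y * shifty Phi z x y = 0"
proof -
  have D: "inD x y" using b by (simp add: onbd_def inD_def)
  obtain f where f: "f > 0" "hxx Phi z x y = f" "hyy Phi z x y = f" "hxy Phi z x y = 0"
    using isothermalE[OF D] .
  obtain a b where n: "bdry_normal Phi z x y = a *\<^sub>R px Phi z x y + b *\<^sub>R py Phi z x y"
    using bc b unfolding boundary_compatible_def by blast
  let ?Z = "pz Phi z x y" and ?X = "px Phi z x y" and ?Y = "py Phi z x y"
  have h: "?X \<bullet> ?X = f" "?X \<bullet> ?Y = 0" "?Y \<bullet> ?X = 0" "?Y \<bullet> ?Y = f"
    using f by (auto simp: hxx_def hxy_def hyy_def gc_def pdir_simps inner_commute)
  have "bdry_normal Phi z x y \<bullet> ?X = - x * omega Phi z x y"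
    "bdry_normal Phi z x y \<bullet> ?Y = - y * omega Phi z x y" "bdry_normal Phi z x y \<bullet> ?Z = 0"
    by (simp_all add: bdry_normal_def omega_def cross3_def inner_vec_def sum_3 algebra_simps)
  then have "a * f = - x * omega Phi z x y" "b * f = - y * omega Phi z x y" "a * (?Z \<bullet> ?X) + b * (?Z \<bullet> ?Y) = 0"
    unfolding n by (simp_all add: inner_add_left inner_add_right h inner_commute[of _ ?Z])
  then have "omega Phi z x y * (x * (?Z \<bullet> ?X) + y * (?Z \<bullet> ?Y)) = 0"
    by algebra
  then have "x * (?Z \<bullet> ?X) + y * (?Z \<bullet> ?Y) = 0" using omega_pos[OF D, of z] by simp
  then have "(x * (?Z \<bullet> ?X) + y * (?Z \<bullet> ?Y)) / f = 0" by simp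
  moreover have "shiftx Phi z x y = (?Z \<bullet> ?X) / f" "shifty Phi z x y = (?Z \<bullet> ?Y) / f"
    using f(1) by (simp_all add: shiftx_def shifty_def sharpx_def sharpy_def hixx_def hixy_def hiyy_def hdet_def
        f(2-4) gc_def pdir_simps)
  ultimately show ?thesis by (simp add: add_divide_distrib)
qed

lemma smooth_representatives:
  obtains G ixx ixy iyy N1 N2 L iw where "open G" "\<And>z x y. inD x y \<Longrightarrow> (z, x, y) \<in> G"
    "smooth3 ixx" "smooth3 ixy" "smooth3 iyy" "smooth3 N1" "smooth3 N2" "smooth3 L" "smooth3 iw"
    "\<And>z x y. (z, x, y) \<in> G \<Longrightarrow> hixx Phi z x y = ixx z x y \<and> hixy Phi z x y = ixy z x y \<and>
       hiyy Phi z x y = iyy z x y \<and> shiftx Phi z x y = N1 z x y \<and> shifty Phi z x y = N2 z x y \<and>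
       lapse_sq Phi z x y = L z x y \<and> omega Phi z x y \<noteq> 0 \<and> iw z x y = 1 / omega Phi z x y"
proof -
  have perg: "gc Phi i j (z + 2 * pi) x y = gc Phi i j z x y" for i j z x y
    by (simp add: gc_def pdir_periodic)
  have "hdet Phi (z + 2 * pi) x y = hdet Phi z x y" for z x y
    by (simp add: hdet_def hxx_def hxy_def hyy_def perg)
  from periodic_positive_reciprocal[OF hdet_smooth this hdet_pos]
  obtain ih O1 where ih: "smooth3 ih" "open O1" "\<And>z x y. inD x y \<Longrightarrow> (z, x, y) \<in> O1"
    "\<And>z x y. (z, x, y) \<in> O1 \<Longrightarrow> hdet Phi z x y \<noteq> 0 \<and> ih z x y = 1 / hdet Phi z x y" by blast
  have "omega Phi (z + 2 * pi) x y = omega Phi z x y" for z x y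
    using pdir_periodic[of 0] pdir_periodic[of 1] pdir_periodic[of 2] by (simp add: omega_def pdir_simps)
  from periodic_positive_reciprocal[OF omega_smooth this omega_pos]
  obtain iw O2 where iw: "smooth3 iw" "open O2" "\<And>z x y. inD x y \<Longrightarrow> (z, x, y) \<in> O2"
    "\<And>z x y. (z, x, y) \<in> O2 \<Longrightarrow> omega Phi z x y \<noteq> 0 \<and> iw z x y = 1 / omega Phi z x y" by blast
  define ixx where "ixx = (\<lambda>z x y. hyy Phi z x y * ih z x y)"
  define ixy where "ixy = (\<lambda>z x y. - (hxy Phi z x y * ih z x y))"
  define iyy where "iyy = (\<lambda>z x y. hxx Phi z x y * ih z x y)"
  have i: "smooth3 ixx" "smooth3 ixy" "smooth3 iyy"
    unfolding ixx_def ixy_def iyy_def by (intro smooth3_mult smooth3_uminus h_smooth ih)+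
  define N1 where "N1 = (\<lambda>z x y. ixx z x y * gc Phi 0 1 z x y + ixy z x y * gc Phi 0 2 z x y)"
  define N2 where "N2 = (\<lambda>z x y. ixy z x y * gc Phi 0 1 z x y + iyy z x y * gc Phi 0 2 z x y)"
  have N: "smooth3 N1" "smooth3 N2"
    unfolding N1_def N2_def by (intro smooth3_mult smooth3_add i gc_smooth)+
  define L where "L = (\<lambda>z x y. gc Phi 0 0 z x y
     - (N1 z x y * (hxx Phi z x y * N1 z x y + hxy Phi z x y * N2 z x y)
        + N2 z x y * (hxy Phi z x y * N1 z x y + hyy Phi z x y * N2 z x y)))"
  have L: "smooth3 L"
    unfolding L_def by (intro smooth3_diff smooth3_mult smooth3_add N h_smooth gc_smooth)
  show ?thesis
  proof (rule that[of "O1 \<inter> O2" ixx ixy iyy N1 N2 L iw])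
    fix z x y assume o: "(z, x, y) \<in> O1 \<inter> O2"
    have hi: "hixx Phi z x y = ixx z x y" "hixy Phi z x y = ixy z x y" "hiyy Phi z x y = iyy z x y"
      using ih(4) o by (auto simp: hixx_def hixy_def hiyy_def ixx_def ixy_def iyy_def)
    have s: "shiftx Phi z x y = N1 z x y" "shifty Phi z x y = N2 z x y"
      by (simp_all add: shiftx_def shifty_def sharpx_def sharpy_def N1_def N2_def hi)
    have "lapse_sq Phi z x y = L z x y"
      by (simp add: lapse_sq_def flatx_def flaty_def s L_def)
    then show "hixx Phi z x y = ixx z x y \<and> hixy Phi z x y = ixy z x y \<and>
       hiyy Phi z x y = iyy z x y \<and> shiftx Phi z x y = N1 z x y \<and> shifty Phi z x y = N2 z x y \<and>
       lapse_sq Phi z x y = L z x y \<and> omega Phi z x y \<noteq> 0 \<and> iw z x y = 1 / omega Phi z x y"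
      using hi s iw(4) o by auto
  qed (use ih iw i N L in auto)
qed

lemma flat_sharp:
  assumes "inD x y"
  shows "flatx Phi z x y (sharpx Phi z x y a b) (sharpy Phi z x y a b) = a"
    "flaty Phi z x y (sharpx Phi z x y a b) (sharpy Phi z x y a b) = b"
    "sharpx Phi z x y (flatx Phi z x y a b) (flaty Phi z x y a b) = a"
    "sharpy Phi z x y (flatx Phi z x y a b) (flaty Phi z x y a b) = b"
  by (rule isothermalE[OF assms, of z];
      simp add: flatx_def flaty_def sharpx_def sharpy_def hixx_def hixy_def hiyy_def hdet_def)+

end

subsection \<open>The functional derivative of the Hamiltonian\<close>

text \<open>The arguments \<open>i11, i12, i22, w, L, N1, N2\<close> are the values at a point of the inverse metric,
  of \<open>\<omega>\<^sub>\<zeta>\<close>, of the squared lapse and of the shift.\<close>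

definition ham_density :: "real \<Rightarrow> real \<Rightarrow> real \<Rightarrow> real \<Rightarrow> real \<Rightarrow> real \<Rightarrow> real \<Rightarrow> real \<Rightarrow> real \<Rightarrow> real \<Rightarrow> real \<Rightarrow> real" where
  "ham_density i11 i12 i22 w L N1 N2 a b s t =
     (1/2 * (a / s * (i11 * (a / s) + i12 * (b / s)) + b / s * (i12 * (a / s) + i22 * (b / s)))
       + t / s - 1/2 * (s / w)\<^sup>2 * L) * w - (a * N1 + b * N2)"

definition ham_variation :: "real \<Rightarrow> real \<Rightarrow> real \<Rightarrow> real \<Rightarrow> real \<Rightarrow> real \<Rightarrow> real \<Rightarrow> real \<Rightarrow> real \<Rightarrow> real \<Rightarrow> real \<Rightarrow>
    real \<Rightarrow> real \<Rightarrow> real \<Rightarrow> real \<Rightarrow> real" where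
  "ham_variation i11 i12 i22 w L N1 N2 a b s t da db ds dt =
     da * (w / s * (i11 * (a / s) + i12 * (b / s)) - N1)
     + db * (w / s * (i12 * (a / s) + i22 * (b / s)) - N2)
     + ds * (- (w / s * (a / s * (i11 * (a / s) + i12 * (b / s)) + b / s * (i12 * (a / s) + i22 * (b / s)) + t / s))
         - s / w * L)
     + dt * (w / s)"

lemma has_derivative_ham_density:
  assumes "S \<noteq> 0" "w \<noteq> 0" "S = s + l * ds"
  shows "((\<lambda>l. ham_density i11 i12 i22 w L N1 N2 (a + l * da) (b + l * db) (s + l * ds) (t + l * dt))
    has_real_derivative
      ham_variation i11 i12 i22 w L N1 N2 (a + l * da) (b + l * db) S (t + l * dt) da db ds dt) (at l)"
proof -
  have q: "((\<lambda>l. (u + l * du) / (s + l * ds)) has_real_derivative (du - (u + l * du) / S * ds) * (1 / S)) (at l)" for u du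
    using assms by (auto intro!: derivative_eq_intros simp: field_simps)
  define A where "A = (\<lambda>l. (a + l * da) / (s + l * ds))"
  define B where "B = (\<lambda>l. (b + l * db) / (s + l * ds))"
  define T where "T = (\<lambda>l. (t + l * dt) / (s + l * ds))"
  define v where "v = 1 / w"
  define k where "k = 1 / S"
  have v: "v * w = 1" using assms by (simp add: v_def)
  have d: "(A has_real_derivative (da - A l * ds) * k) (at l)" "(B has_real_derivative (db - B l * ds) * k) (at l)"
    "(T has_real_derivative (dt - T l * ds) * k) (at l)"
    using q assms unfolding A_def B_def T_def k_def by auto
  have "((\<lambda>l. (1/2 * (A l * (i11 * A l + i12 * B l) + B l * (i12 * A l + i22 * B l))
        + T l - 1/2 * ((s + l * ds) * v)\<^sup>2 * L) * w - ((a + l * da) * N1 + (b + l * db) * N2)) has_real_derivative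
     ((((da - A l * ds) * k) * (i11 * A l + i12 * B l) + ((db - B l * ds) * k) * (i12 * A l + i22 * B l)
        + (dt - T l * ds) * k) * w - S * v * ds * L * (v * w) - (da * N1 + db * N2))) (at l)"
    using assms(3) by (auto intro!: derivative_eq_intros d simp: field_simps power2_eq_square)
  moreover have "(((da - A l * ds) * k) * (i11 * A l + i12 * B l) + ((db - B l * ds) * k) * (i12 * A l + i22 * B l)
        + (dt - T l * ds) * k) * w - S * v * ds * L * (v * w) - (da * N1 + db * N2)
    = da * (w * k * (i11 * A l + i12 * B l) - N1) + db * (w * k * (i12 * A l + i22 * B l) - N2)
    + ds * (- (w * k * (A l * (i11 * A l + i12 * B l) + B l * (i12 * A l + i22 * B l) + T l)) - S * v * L)
    + dt * (w * k)"
    unfolding v by (simp add: algebra_simps)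
  ultimately show ?thesis
    using assms(3) unfolding ham_density_def ham_variation_def A_def B_def T_def v_def k_def by simp
qed

lemma has_derivative_integral_ham_density:
  fixes i11 i12 i22 w L N1 N2 a b s t da db ds dt :: "real \<times> real \<Rightarrow> real"
  assumes c: "continuous_on Dset i11" "continuous_on Dset i12" "continuous_on Dset i22" "continuous_on Dset w"
    "continuous_on Dset L" "continuous_on Dset N1" "continuous_on Dset N2"
    "continuous_on Dset a" "continuous_on Dset b" "continuous_on Dset s" "continuous_on Dset t"
    "continuous_on Dset da" "continuous_on Dset db" "continuous_on Dset ds" "continuous_on Dset dt"
    and nz: "\<And>q. q \<in> Dset \<Longrightarrow> s q \<noteq> 0" "\<And>q. q \<in> Dset \<Longrightarrow> w q \<noteq> 0"
  shows "((\<lambda>l. integral Dset (\<lambda>q. ham_density (i11 q) (i12 q) (i22 q) (w q) (L q) (N1 q) (N2 q)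
        (a q + l * da q) (b q + l * db q) (s q + l * ds q) (t q + l * dt q))) has_real_derivative
     integral Dset (\<lambda>q. ham_variation (i11 q) (i12 q) (i22 q) (w q) (L q) (N1 q) (N2 q)
        (a q) (b q) (s q) (t q) (da q) (db q) (ds q) (dt q))) (at 0)"
proof -
  have ne: "Dset \<noteq> {}" by (simp add: Dset_eq_cball)
  obtain m where m: "m \<in> Dset" "\<And>q. q \<in> Dset \<Longrightarrow> \<bar>s m\<bar> \<le> \<bar>s q\<bar>"
    using continuous_attains_inf[OF compact_Dset ne continuous_on_rabs[OF c(10)]] by blast
  obtain n where n: "n \<in> Dset" "\<And>q. q \<in> Dset \<Longrightarrow> \<bar>ds q\<bar> \<le> \<bar>ds n\<bar>"
    using continuous_attains_sup[OF compact_Dset ne continuous_on_rabs[OF c(14)]] by blast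
  define K where "K = \<bar>ds n\<bar> + 1"
  have K: "K > 0" by (simp add: K_def)
  define e where "e = \<bar>s m\<bar> / (2 * K)"
  have e: "e > 0" using nz(1)[OF m(1)] K by (simp add: e_def)
  have S: "s q + l * ds q \<noteq> 0" if "\<bar>l\<bar> \<le> e" "q \<in> Dset" for l q
  proof -
    have "\<bar>l * ds q\<bar> \<le> e * \<bar>ds n\<bar>" unfolding abs_mult using that n e by (intro mult_mono) auto
    also have "\<dots> \<le> e * K" using e by (simp add: K_def)
    also have "\<dots> = \<bar>s m\<bar> / 2" using K by (simp add: e_def)
    finally show ?thesis using m(2)[OF that(2)] nz(1)[OF m(1)] by auto
  qed
  define f where "f l q = ham_density (i11 q) (i12 q) (i22 q) (w q) (L q) (N1 q) (N2 q)
        (a q + l * da q) (b q + l * db q) (s q + l * ds q) (t q + l * dt q)" for l q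
  define f' where "f' l q = ham_variation (i11 q) (i12 q) (i22 q) (w q) (L q) (N1 q) (N2 q)
        (a q + l * da q) (b q + l * db q) (s q + l * ds q) (t q + l * dt q) (da q) (db q) (ds q) (dt q)" for l q
  have "((\<lambda>l. integral Dset (f l)) has_real_derivative integral Dset (f' 0)) (at 0)"
  proof (rule has_derivative_integral_compact[OF compact_Dset e])
    fix l :: real and q assume "\<bar>l - 0\<bar> \<le> e" "q \<in> Dset"
    then show "((\<lambda>l. f l q) has_real_derivative f' l q) (at l)"
      unfolding f_def f'_def using S nz by (intro has_derivative_ham_density) auto
  next
    fix l :: real assume "\<bar>l - 0\<bar> \<le> e"
    then show "continuous_on Dset (f l)"
      unfolding f_def ham_density_def
      using S nz by (intro continuous_on_add continuous_on_diff continuous_on_mult continuous_on_divide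
          continuous_on_power continuous_on_const c) auto
  next
    have cs: "continuous_on ({0 - e..0 + e} \<times> Dset) (\<lambda>p. g (snd p))" if "continuous_on Dset g"
      for g :: "real \<times> real \<Rightarrow> real"
      by (rule continuous_on_compose2[OF that continuous_on_snd[OF continuous_on_id]]) auto
    show "continuous_on ({0 - e..0 + e} \<times> Dset) (\<lambda>(l, q). f' l q)"
      unfolding f'_def ham_variation_def case_prod_unfold using S nz
      by (intro continuous_on_add continuous_on_diff continuous_on_minus continuous_on_mult continuous_on_divide
          continuous_on_const c[THEN cs] continuous_on_fst continuous_on_id) auto
  qed
  then show ?thesis unfolding f_def f'_def by simp
qed

subsection \<open>Equivalence of the two formulations\<close>

definition momx :: "(real^3) efun \<Rightarrow> real efun \<Rightarrow> real efun \<Rightarrow> real efun \<Rightarrow> real efun" where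
  "momx Phi rho ux uy z x y = rho z x y / omega Phi z x y *
     flatx Phi z x y (ux z x y + shiftx Phi z x y) (uy z x y + shifty Phi z x y)"

definition momy :: "(real^3) efun \<Rightarrow> real efun \<Rightarrow> real efun \<Rightarrow> real efun \<Rightarrow> real efun" where
  "momy Phi rho ux uy z x y = rho z x y / omega Phi z x y *
     flaty Phi z x y (ux z x y + shiftx Phi z x y) (uy z x y + shifty Phi z x y)"

definition energy :: "(real^3) efun \<Rightarrow> real efun \<Rightarrow> real efun \<Rightarrow> real efun \<Rightarrow> real efun" where
  "energy Phi rho ux uy z x y =
     normsq1 Phi z x y (momx Phi rho ux uy z x y) (momy Phi rho ux uy z x y) / (rho z x y / omega Phi z x y)
     + rho z x y / omega Phi z x y * lapse_sq Phi z x y"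

definition euler_at :: "(real^3) efun \<Rightarrow> real efun \<Rightarrow> real efun \<Rightarrow> real efun \<Rightarrow> real efun \<Rightarrow>
    real \<Rightarrow> real \<Rightarrow> real \<Rightarrow> bool" where
  "euler_at Phi rho ux uy p z x y \<longleftrightarrow>
     (let mx = momx Phi rho ux uy; my = momy Phi rho ux uy; E = energy Phi rho ux uy in
     pz p z x y + ux z x y * px p z x y + uy z x y * py p z x y = 0 \<and>
     pz rho z x y + flux_div rho ux uy z x y = 0 \<and>
     pz mx z x y + ux z x y * px mx z x y + uy z x y * py mx z x y
       + mx z x y * px ux z x y + my z x y * px uy z x y
       = px p z x y * (omega Phi z x y / rho z x y) + px E z x y \<and>
     pz my z x y + ux z x y * px my z x y + uy z x y * py my z x y
       + mx z x y * py ux z x y + my z x y * py uy z x y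
       = py p z x y * (omega Phi z x y / rho z x y) + py E z x y)"

lemma euler_cond_iff:
  "euler_cond Phi rho ux uy p \<longleftrightarrow>
    (\<forall>z x y. onbd x y \<longrightarrow> x * ux z x y + y * uy z x y = 0) \<and>
    (\<forall>z x y. inD x y \<longrightarrow> euler_at Phi rho ux uy p z x y)"
  unfolding euler_cond_def euler_at_def Let_def momx_def[abs_def] momy_def[abs_def] energy_def[abs_def] flux_div_def
  by (simp add: add.assoc)

lemma px_uminus:
  fixes f :: "real efun"
  shows "smooth3 f \<Longrightarrow> px (\<lambda>z x y. - f z x y) z x y = - px f z x y"
    and py_uminus: "smooth3 f \<Longrightarrow> py (\<lambda>z x y. - f z x y) z x y = - py f z x y"
  using px_mult[of "\<lambda>z x y. -1" f z x y] py_mult[of "\<lambda>z x y. -1" f z x y]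
  by (simp_all add: px_def[of "\<lambda>z x y. -1"] py_def[of "\<lambda>z x y. -1"])

lemma pdir_eq_of_eq_on_open:
  assumes "smooth3 g" "open G" "(z, x, y) \<in> G" "\<forall>z x y. (z, x, y) \<in> G \<longrightarrow> f z x y = g z x y"
  shows "pz f z x y = pz g z x y" "px f z x y = px g z x y" "py f z x y = py g z x y"
proof -
  have "pdir d f z x y = pdir d g z x y" for d
    using has_pdir_transform_open[OF smooth3_has_pdir[OF assms(1)] assms(2,3)] assms(4)
    by (intro has_pdir_imp_pdir) metis
  from this[of 0] this[of 1] this[of 2]
  show "pz f z x y = pz g z x y" "px f z x y = px g z x y" "py f z x y = py g z x y"
    by (simp_all add: pdir_simps)
qed

context isothermal_torus
begin

lemma velocity_iff_momentum:
  assumes D: "inD x y" and s: "rho z x y \<noteq> 0"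
  shows "(ux z x y = omega Phi z x y / rho z x y * sharpx Phi z x y (a / rho z x y) (b / rho z x y) - shiftx Phi z x y \<and>
     uy z x y = omega Phi z x y / rho z x y * sharpy Phi z x y (a / rho z x y) (b / rho z x y) - shifty Phi z x y) \<longleftrightarrow>
    (a = rho z x y * momx Phi rho ux uy z x y \<and> b = rho z x y * momy Phi rho ux uy z x y)"
proof -
  let ?w = "omega Phi z x y" and ?s = "rho z x y"
  have w: "?w \<noteq> 0" using omega_pos[OF D, of z] by simp
  have lin: "flatx Phi z x y (c * u) (c * v) = c * flatx Phi z x y u v"
    "flaty Phi z x y (c * u) (c * v) = c * flaty Phi z x y u v"
    "sharpx Phi z x y (c * u) (c * v) = c * sharpx Phi z x y u v"
    "sharpy Phi z x y (c * u) (c * v) = c * sharpy Phi z x y u v" for c u v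
    by (simp_all add: flatx_def flaty_def sharpx_def sharpy_def algebra_simps)
  show ?thesis
  proof
    assume "ux z x y = ?w / ?s * sharpx Phi z x y (a / ?s) (b / ?s) - shiftx Phi z x y \<and>
      uy z x y = ?w / ?s * sharpy Phi z x y (a / ?s) (b / ?s) - shifty Phi z x y"
    then have "ux z x y + shiftx Phi z x y = ?w / ?s * sharpx Phi z x y (a / ?s) (b / ?s)"
      "uy z x y + shifty Phi z x y = ?w / ?s * sharpy Phi z x y (a / ?s) (b / ?s)" by auto
    then have "momx Phi rho ux uy z x y = ?s / ?w * (?w / ?s * (a / ?s))"
      "momy Phi rho ux uy z x y = ?s / ?w * (?w / ?s * (b / ?s))"
      by (simp_all only: momx_def momy_def lin flat_sharp[OF D])
    then show "a = ?s * momx Phi rho ux uy z x y \<and> b = ?s * momy Phi rho ux uy z x y"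
      using w s by simp
  next
    assume "a = ?s * momx Phi rho ux uy z x y \<and> b = ?s * momy Phi rho ux uy z x y"
    then have ab: "a / ?s = momx Phi rho ux uy z x y" "b / ?s = momy Phi rho ux uy z x y" using s by auto
    have "sharpx Phi z x y (a / ?s) (b / ?s) = ?s / ?w * (ux z x y + shiftx Phi z x y)"
      "sharpy Phi z x y (a / ?s) (b / ?s) = ?s / ?w * (uy z x y + shifty Phi z x y)"
      unfolding ab by (simp_all only: momx_def momy_def lin flat_sharp[OF D])
    then show "ux z x y = ?w / ?s * sharpx Phi z x y (a / ?s) (b / ?s) - shiftx Phi z x y \<and>
      uy z x y = ?w / ?s * sharpy Phi z x y (a / ?s) (b / ?s) - shifty Phi z x y"
      using w s by simp
  qed
qed

lemma momentum_normal:
  assumes b: "onbd x y" and s: "rho z x y \<noteq> 0"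
  shows "x * momx Phi rho ux uy z x y + y * momy Phi rho ux uy z x y = 0 \<longleftrightarrow>
    x * ux z x y + y * uy z x y = 0"
proof -
  have D: "inD x y" using b by (simp add: onbd_def inD_def)
  obtain f where f: "f > 0" "hxx Phi z x y = f" "hyy Phi z x y = f" "hxy Phi z x y = 0"
    using isothermalE[OF D] .
  have "x * momx Phi rho ux uy z x y + y * momy Phi rho ux uy z x y
     = rho z x y / omega Phi z x y * f * ((x * ux z x y + y * uy z x y)
        + (x * shiftx Phi z x y + y * shifty Phi z x y))"
    by (simp add: momx_def momy_def flatx_def flaty_def f algebra_simps)
  then show ?thesis using shift_tangent[OF b] s f(1) omega_pos[OF D, of z] by simp
qed

lemma hamilton_iff_euler:
  fixes rho ux uy p :: "real efun"
  assumes sm: "smooth3 rho" "smooth3 ux" "smooth3 uy" "smooth3 p"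
    and nz: "\<And>z x y. inD x y \<Longrightarrow> rho z x y \<noteq> 0"
    and X: "smooth_curve X"
    and XD: "\<And>z x y. inD x y \<Longrightarrow> pU1 (X z) x y = rho z x y * momx Phi rho ux uy z x y \<and>
      pU2 (X z) x y = rho z x y * momy Phi rho ux uy z x y \<and> pS (X z) x y = rho z x y \<and>
      pT (X z) x y = rho z x y * p z x y"
    and tan: "\<And>z x y. onbd x y \<Longrightarrow> x * ux z x y + y * uy z x y = 0"
  shows "hamilton (Ham Phi) X \<longleftrightarrow> (\<forall>z x y. inD x y \<longrightarrow> euler_at Phi rho ux uy p z x y)"
proof -
  obtain G ixx ixy iyy N1 N2 L iw where G: "open G" "\<And>z x y. inD x y \<Longrightarrow> (z, x, y) \<in> G"
    and sg: "smooth3 ixx" "smooth3 ixy" "smooth3 iyy" "smooth3 N1" "smooth3 N2" "smooth3 L" "smooth3 iw"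
    and eq: "\<And>z x y. (z, x, y) \<in> G \<Longrightarrow> hixx Phi z x y = ixx z x y \<and> hixy Phi z x y = ixy z x y \<and>
       hiyy Phi z x y = iyy z x y \<and> shiftx Phi z x y = N1 z x y \<and> shifty Phi z x y = N2 z x y \<and>
       lapse_sq Phi z x y = L z x y \<and> omega Phi z x y \<noteq> 0 \<and> iw z x y = 1 / omega Phi z x y"
    using smooth_representatives by blast
  define P where "P = (\<lambda>z x y. rho z x y * iw z x y * (hxx Phi z x y * (ux z x y + N1 z x y) + hxy Phi z x y * (uy z x y + N2 z x y)))"
  define Q where "Q = (\<lambda>z x y. rho z x y * iw z x y * (hxy Phi z x y * (ux z x y + N1 z x y) + hyy Phi z x y * (uy z x y + N2 z x y)))"
  have PQ: "smooth3 P" "smooth3 Q"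
    unfolding P_def Q_def by (intro smooth3_mult smooth3_add sm sg h_smooth)+
  have mom: "momx Phi rho ux uy z x y = P z x y" "momy Phi rho ux uy z x y = Q z x y"
    if "(z, x, y) \<in> G" for z x y
    using eq[OF that] by (simp_all add: momx_def momy_def flatx_def flaty_def P_def Q_def)
  note sX = smooth_curveD(1-4)[OF X]
  have XG: "pU1 (X z) x y = rho z x y * P z x y" "pU2 (X z) x y = rho z x y * Q z x y"
    "pS (X z) x y = rho z x y" "pT (X z) x y = rho z x y * p z x y" if "inD x y" for z x y
    using XD[OF that] mom[OF G(2)[OF that]] by auto
  have mom': "\<forall>z x y. (z, x, y) \<in> G \<longrightarrow> momx Phi rho ux uy z x y = P z x y"
    "\<forall>z x y. (z, x, y) \<in> G \<longrightarrow> momy Phi rho ux uy z x y = Q z x y"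
    using mom by blast+
  note md = pdir_eq_of_eq_on_open[OF PQ(1) G(1) G(2) mom'(1)] pdir_eq_of_eq_on_open[OF PQ(2) G(1) G(2) mom'(2)]
  have sRX: "smooth3 (\<lambda>z x y. rho z x y * P z x y)" "smooth3 (\<lambda>z x y. rho z x y * Q z x y)"
    "smooth3 (\<lambda>z x y. rho z x y * p z x y)"
    by (intro smooth3_mult sm PQ)+
  have pzX: "pz (\<lambda>z. pU1 (X z)) z x y = rho z x y * pz P z x y + pz rho z x y * P z x y"
    "pz (\<lambda>z. pU2 (X z)) z x y = rho z x y * pz Q z x y + pz rho z x y * Q z x y"
    "pz (\<lambda>z. pS (X z)) z x y = pz rho z x y"
    "pz (\<lambda>z. pT (X z)) z x y = rho z x y * pz p z x y + pz rho z x y * p z x y" if "inD x y" for z x y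
  proof -
    have "pz (\<lambda>z. pU1 (X z)) z x y = pz (\<lambda>z x y. rho z x y * P z x y) z x y"
      "pz (\<lambda>z. pU2 (X z)) z x y = pz (\<lambda>z x y. rho z x y * Q z x y) z x y"
      "pz (\<lambda>z. pT (X z)) z x y = pz (\<lambda>z x y. rho z x y * p z x y) z x y"
      unfolding pz_def by (simp_all add: XG[OF that])
    then show "pz (\<lambda>z. pU1 (X z)) z x y = rho z x y * pz P z x y + pz rho z x y * P z x y"
      "pz (\<lambda>z. pU2 (X z)) z x y = rho z x y * pz Q z x y + pz rho z x y * Q z x y"
      "pz (\<lambda>z. pT (X z)) z x y = rho z x y * pz p z x y + pz rho z x y * p z x y"
      by (simp_all add: pz_mult sm PQ)
    show "pz (\<lambda>z. pS (X z)) z x y = pz rho z x y"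
      unfolding pz_def by (simp add: XG[OF that])
  qed
  have dX: "px (\<lambda>z. pU1 (X z)) z x y = rho z x y * px P z x y + px rho z x y * P z x y"
    "py (\<lambda>z. pU1 (X z)) z x y = rho z x y * py P z x y + py rho z x y * P z x y"
    "px (\<lambda>z. pU2 (X z)) z x y = rho z x y * px Q z x y + px rho z x y * Q z x y"
    "py (\<lambda>z. pU2 (X z)) z x y = rho z x y * py Q z x y + py rho z x y * Q z x y"
    "px (\<lambda>z. pS (X z)) z x y = px rho z x y"
    "py (\<lambda>z. pS (X z)) z x y = py rho z x y"
    "px (\<lambda>z. pT (X z)) z x y = rho z x y * px p z x y + px rho z x y * p z x y"
    "py (\<lambda>z. pT (X z)) z x y = rho z x y * py p z x y + py rho z x y * p z x y" if D: "inD x y" for z x y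
    using smooth3_agree_on_disc_imp_derivs_agree[OF sX(1) sRX(1) XG(1) D, of z]
      smooth3_agree_on_disc_imp_derivs_agree[OF sX(2) sRX(2) XG(2) D, of z]
      smooth3_agree_on_disc_imp_derivs_agree[OF sX(3) sm(1) XG(3) D, of z]
      smooth3_agree_on_disc_imp_derivs_agree[OF sX(4) sRX(3) XG(4) D, of z]
    by (simp_all add: px_mult py_mult sm PQ)
  have "\<exists>E. is_fderiv (Ham Phi z) (X z) E \<and>
     ((\<forall>A. in_p A \<longrightarrow> pairing (dcurve X z) A = pairing (X z) (pbracket A E)) \<longleftrightarrow>
      (\<forall>x y. inD x y \<longrightarrow> euler_at Phi rho ux uy p z x y))" for z
  proof -
    obtain ir G' where ir: "smooth3 ir" "open G'" "\<And>x y. inD x y \<Longrightarrow> (z, x, y) \<in> G'"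
      "\<And>z x y. (z, x, y) \<in> G' \<Longrightarrow> rho z x y \<noteq> 0 \<and> ir z x y = 1 / rho z x y"
      using nonvanishing_on_slice_reciprocal[where a = rho and z = z, OF sm(1) nz] by blast
    define TT where "TT = (\<lambda>z x y. omega Phi z x y * ir z x y)"
    define EE where "EE = (\<lambda>z x y. (P z x y * (ixx z x y * P z x y + ixy z x y * Q z x y)
        + Q z x y * (ixy z x y * P z x y + iyy z x y * Q z x y)) * TT z x y + rho z x y * iw z x y * L z x y)"
    define SS where "SS = (\<lambda>z x y. - (EE z x y + p z x y * TT z x y))"
    have sT: "smooth3 TT" unfolding TT_def by (intro smooth3_mult omega_smooth ir)
    have sE: "smooth3 EE" unfolding EE_def by (intro smooth3_add smooth3_mult PQ sg sm sT)
    have sS: "smooth3 SS" unfolding SS_def by (intro smooth3_uminus smooth3_add smooth3_mult sE sm sT)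
    have en: "\<forall>z x y. (z, x, y) \<in> G \<inter> G' \<longrightarrow> energy Phi rho ux uy z x y = EE z x y"
      using eq mom ir(4) by (simp add: energy_def EE_def TT_def normsq1_def sharpx_def sharpy_def)
    have GG: "open (G \<inter> G')" "\<And>x y. inD x y \<Longrightarrow> (z, x, y) \<in> G \<inter> G'" using G ir by auto
    note ed = pdir_eq_of_eq_on_open[OF sE GG(1) GG(2) en]
    define E where "E = \<lparr>pU1 = ux z, pU2 = uy z, pS = SS z, pT = TT z\<rparr>"
    have pE: "in_p E"
      unfolding in_p_def E_def using tan by (simp add: smooth2_slice sm sS sT)
    have fd: "is_fderiv (Ham Phi z) (X z) E"
      unfolding is_fderiv_def
    proof (intro conjI allI impI pE)
      fix dY assume dY: "in_pstar dY"
      have cg: "continuous_on Dset (\<lambda>q. g z (fst q) (snd q))"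
        if "smooth3 f" "\<And>x y. inD x y \<Longrightarrow> g z x y = f z x y" for f g :: "real efun"
        using continuous_on_cong[of Dset Dset "\<lambda>q. g z (fst q) (snd q)" "\<lambda>q. f z (fst q) (snd q)"]
          smooth3_continuous_on_slice[OF that(1), of Dset z] that(2) by (simp add: Dset_def)
      have cc: "continuous_on Dset (\<lambda>q. hixx Phi z (fst q) (snd q))"
        "continuous_on Dset (\<lambda>q. hixy Phi z (fst q) (snd q))"
        "continuous_on Dset (\<lambda>q. hiyy Phi z (fst q) (snd q))"
        "continuous_on Dset (\<lambda>q. omega Phi z (fst q) (snd q))"
        "continuous_on Dset (\<lambda>q. lapse_sq Phi z (fst q) (snd q))"
        "continuous_on Dset (\<lambda>q. shiftx Phi z (fst q) (snd q))"
        "continuous_on Dset (\<lambda>q. shifty Phi z (fst q) (snd q))"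
        using cg[OF sg(1), of "hixx Phi"] cg[OF sg(2), of "hixy Phi"] cg[OF sg(3), of "hiyy Phi"]
          cg[OF omega_smooth, of "omega Phi"] cg[OF sg(6), of "lapse_sq Phi"]
          cg[OF sg(4), of "shiftx Phi"] cg[OF sg(5), of "shifty Phi"] eq[OF G(2), of _ _ z] by auto
      have cX: "comp_smooth (X z)" "comp_smooth dY"
        using in_pstar_comp_smooth dY smooth_curveD(5)[OF X] by auto
      have nzq: "pS (X z) (fst q) (snd q) \<noteq> 0" "omega Phi z (fst q) (snd q) \<noteq> 0" if "q \<in> Dset" for q
        using that XG(3) nz eq[OF G(2)] by (auto simp: Dset_def)
      note hd = has_derivative_integral_ham_density[OF cc
          smooth2_continuous_on[of "pU1 (X z)"] smooth2_continuous_on[of "pU2 (X z)"]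
          smooth2_continuous_on[of "pS (X z)"] smooth2_continuous_on[of "pT (X z)"]
          smooth2_continuous_on[of "pU1 dY"] smooth2_continuous_on[of "pU2 dY"]
          smooth2_continuous_on[of "pS dY"] smooth2_continuous_on[of "pT dY"] nzq]
      let ?v = "\<lambda>x y. ham_variation (hixx Phi z x y) (hixy Phi z x y) (hiyy Phi z x y) (omega Phi z x y)
          (lapse_sq Phi z x y) (shiftx Phi z x y) (shifty Phi z x y) (pU1 (X z) x y) (pU2 (X z) x y)
          (pS (X z) x y) (pT (X z) x y) (pU1 dY x y) (pU2 dY x y) (pS dY x y) (pT dY x y)"
      have "Ham Phi z (padd (X z) (pscale l dY)) = integral Dset (\<lambda>q.
          ham_density (hixx Phi z (fst q) (snd q)) (hixy Phi z (fst q) (snd q)) (hiyy Phi z (fst q) (snd q))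
            (omega Phi z (fst q) (snd q)) (lapse_sq Phi z (fst q) (snd q)) (shiftx Phi z (fst q) (snd q))
            (shifty Phi z (fst q) (snd q)) (pU1 (X z) (fst q) (snd q) + l * pU1 dY (fst q) (snd q))
            (pU2 (X z) (fst q) (snd q) + l * pU2 dY (fst q) (snd q))
            (pS (X z) (fst q) (snd q) + l * pS dY (fst q) (snd q))
            (pT (X z) (fst q) (snd q) + l * pT dY (fst q) (snd q)))" for l
        unfolding Ham_def Let_def padd_def pscale_def pel.simps normsq1_def sharpx_def sharpy_def ham_density_def ..
      then have "((\<lambda>l. Ham Phi z (padd (X z) (pscale l dY))) has_real_derivative
          integral Dset (\<lambda>q. ?v (fst q) (snd q))) (at 0)"
        using hd cX by (simp add: comp_smooth_def)
      also have "integral Dset (\<lambda>q. ?v (fst q) (snd q)) = pairing dY E"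
        unfolding pairing_def E_def pel.simps
      proof (rule integral_cong)
        fix q assume "q \<in> Dset"
        then have D: "inD (fst q) (snd q)" by (simp add: Dset_def)
        let ?x = "fst q" and ?y = "snd q"
        note g = eq[OF G(2)[OF D], of z] and r = ir(4)[OF ir(3)[OF D]] and m = mom[OF G(2)[OF D], of z]
        have u: "omega Phi z ?x ?y / rho z ?x ?y * sharpx Phi z ?x ?y (P z ?x ?y) (Q z ?x ?y) - shiftx Phi z ?x ?y = ux z ?x ?y"
          "omega Phi z ?x ?y / rho z ?x ?y * sharpy Phi z ?x ?y (P z ?x ?y) (Q z ?x ?y) - shifty Phi z ?x ?y = uy z ?x ?y"
          using velocity_iff_momentum[where rho = rho and z = z and ux = ux and uy = uy and a = "rho z ?x ?y * P z ?x ?y"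
              and b = "rho z ?x ?y * Q z ?x ?y", OF D] r m by auto
        have t: "omega Phi z ?x ?y / rho z ?x ?y = TT z ?x ?y" using r by (simp add: TT_def)
        have S: "- (TT z ?x ?y * (P z ?x ?y * (hixx Phi z ?x ?y * P z ?x ?y + hixy Phi z ?x ?y * Q z ?x ?y)
              + Q z ?x ?y * (hixy Phi z ?x ?y * P z ?x ?y + hiyy Phi z ?x ?y * Q z ?x ?y) + p z ?x ?y))
            - rho z ?x ?y / omega Phi z ?x ?y * lapse_sq Phi z ?x ?y = SS z ?x ?y"
          using g by (simp add: SS_def EE_def algebra_simps)
        have c: "pU1 (X z) ?x ?y / pS (X z) ?x ?y = P z ?x ?y" "pU2 (X z) ?x ?y / pS (X z) ?x ?y = Q z ?x ?y"
          "pT (X z) ?x ?y / pS (X z) ?x ?y = p z ?x ?y" "pS (X z) ?x ?y = rho z ?x ?y"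
          using r by (simp_all add: XG[OF D])
        show "?v ?x ?y
          = pU1 dY ?x ?y * ux z ?x ?y + pU2 dY ?x ?y * uy z ?x ?y + pS dY ?x ?y * SS z ?x ?y + pT dY ?x ?y * TT z ?x ?y"
          using u S unfolding ham_variation_def c(1-3) unfolding c(4) t sharpx_def sharpy_def by simp
      qed
      finally show "((\<lambda>l. Ham Phi z (padd (X z) (pscale l dY))) has_real_derivative pairing dY E) (at 0)" .
    qed
    have tan': "\<forall>x y. onbd x y \<longrightarrow> x * ux z x y + y * uy z x y = 0" using tan by blast
    have "(\<forall>A. in_p A \<longrightarrow> pairing (dcurve X z) A = pairing (X z) (pbracket A E)) \<longleftrightarrow>
      (\<forall>x y. inD x y \<longrightarrow> euler_at Phi rho ux uy p z x y)"
      unfolding weak_iff_strong[OF X sm(2,3) sS sT E_def tan']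
    proof (intro all_cong1 imp_cong refl)
      fix x y assume D: "inD x y"
      note fdx = flux_div_eq[OF sX(1) sm(2,3)] flux_div_eq[OF sX(2) sm(2,3)] flux_div_eq[OF sX(3) sm(2,3)]
        flux_div_eq[OF sX(4) sm(2,3)] flux_div_eq[OF sm(1-3)]
      have dS: "px SS z x y = - (px EE z x y + (p z x y * px TT z x y + px p z x y * TT z x y))"
        "py SS z x y = - (py EE z x y + (p z x y * py TT z x y + py p z x y * TT z x y))"
        unfolding SS_def
        by (simp_all only: px_uminus py_uminus px_add py_add px_mult py_mult smooth3_add smooth3_mult sE sT sm)
      have t: "omega Phi z x y / rho z x y = TT z x y" using ir(4)[OF ir(3)[OF D]] by (simp add: TT_def)
      define C where "C = pz rho z x y + flux_div rho ux uy z x y"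
      define T where "T = pz p z x y + ux z x y * px p z x y + uy z x y * py p z x y"
      define F1 where "F1 = pz P z x y + ux z x y * px P z x y + uy z x y * py P z x y
         + P z x y * px ux z x y + Q z x y * px uy z x y - (px p z x y * TT z x y + px EE z x y)"
      define F2 where "F2 = pz Q z x y + ux z x y * px Q z x y + uy z x y * py Q z x y
         + P z x y * py ux z x y + Q z x y * py uy z x y - (py p z x y * TT z x y + py EE z x y)"
      have e: "euler_at Phi rho ux uy p z x y \<longleftrightarrow> T = 0 \<and> C = 0 \<and> F1 = 0 \<and> F2 = 0"
        unfolding euler_at_def Let_def md[OF D] ed[OF D] mom[OF G(2)[OF D]] t T_def C_def F1_def F2_def
        by simp
      have 1: "pz (\<lambda>z. pU1 (X z)) z x y + flux_div (\<lambda>z. pU1 (X z)) ux uy z x y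
         + pU1 (X z) x y * px ux z x y + pU2 (X z) x y * px uy z x y
         + pS (X z) x y * px SS z x y + pT (X z) x y * px TT z x y = rho z x y * F1 + P z x y * C"
        unfolding fdx pzX[OF D] dX[OF D] XG[OF D] dS F1_def C_def by (simp add: algebra_simps)
      have 2: "pz (\<lambda>z. pU2 (X z)) z x y + flux_div (\<lambda>z. pU2 (X z)) ux uy z x y
         + pU1 (X z) x y * py ux z x y + pU2 (X z) x y * py uy z x y
         + pS (X z) x y * py SS z x y + pT (X z) x y * py TT z x y = rho z x y * F2 + Q z x y * C"
        unfolding fdx pzX[OF D] dX[OF D] XG[OF D] dS F2_def C_def by (simp add: algebra_simps)
      have 3: "pz (\<lambda>z. pS (X z)) z x y + flux_div (\<lambda>z. pS (X z)) ux uy z x y = C"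
        unfolding fdx pzX[OF D] dX[OF D] XG[OF D] C_def by simp
      have 4: "pz (\<lambda>z. pT (X z)) z x y + flux_div (\<lambda>z. pT (X z)) ux uy z x y = rho z x y * T + p z x y * C"
        unfolding fdx pzX[OF D] dX[OF D] XG[OF D] C_def T_def by (simp add: algebra_simps)
      show "(pz (\<lambda>z. pU1 (X z)) z x y + flux_div (\<lambda>z. pU1 (X z)) ux uy z x y
         + pU1 (X z) x y * px ux z x y + pU2 (X z) x y * px uy z x y
         + pS (X z) x y * px SS z x y + pT (X z) x y * px TT z x y = 0 \<and>
         pz (\<lambda>z. pU2 (X z)) z x y + flux_div (\<lambda>z. pU2 (X z)) ux uy z x y
         + pU1 (X z) x y * py ux z x y + pU2 (X z) x y * py uy z x y
         + pS (X z) x y * py SS z x y + pT (X z) x y * py TT z x y = 0 \<and>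
         pz (\<lambda>z. pS (X z)) z x y + flux_div (\<lambda>z. pS (X z)) ux uy z x y = 0 \<and>
         pz (\<lambda>z. pT (X z)) z x y + flux_div (\<lambda>z. pT (X z)) ux uy z x y = 0) =
         euler_at Phi rho ux uy p z x y"
        unfolding 1 2 3 4 e using nz[OF D, of z] by auto
    qed
    then show ?thesis using fd by blast
  qed
  then obtain E where E: "\<And>z. is_fderiv (Ham Phi z) (X z) (E z)"
    "\<And>z. (\<forall>A. in_p A \<longrightarrow> pairing (dcurve X z) A = pairing (X z) (pbracket A (E z))) \<longleftrightarrow>
      (\<forall>x y. inD x y \<longrightarrow> euler_at Phi rho ux uy p z x y)"
    by metis
  show ?thesis unfolding hamilton_iff_weak[OF X E(1)] using E(2) by blast
qed

lemma exists_momentum_curve: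
  fixes rho ux uy p :: "real efun"
  assumes sm: "smooth3 rho" "smooth3 ux" "smooth3 uy" "smooth3 p"
    and nz: "\<And>z x y. inD x y \<Longrightarrow> rho z x y \<noteq> 0"
    and tan: "\<And>z x y. onbd x y \<Longrightarrow> x * ux z x y + y * uy z x y = 0"
  obtains X where "smooth_curve X"
    "\<And>z x y. inD x y \<Longrightarrow> pU1 (X z) x y = rho z x y * momx Phi rho ux uy z x y \<and>
      pU2 (X z) x y = rho z x y * momy Phi rho ux uy z x y \<and> pS (X z) x y = rho z x y \<and>
      pT (X z) x y = rho z x y * p z x y"
proof -
  obtain G ixx ixy iyy N1 N2 L iw where G: "open G" "\<And>z x y. inD x y \<Longrightarrow> (z, x, y) \<in> G"
    and sg: "smooth3 ixx" "smooth3 ixy" "smooth3 iyy" "smooth3 N1" "smooth3 N2" "smooth3 L" "smooth3 iw"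
    and eq: "\<And>z x y. (z, x, y) \<in> G \<Longrightarrow> hixx Phi z x y = ixx z x y \<and> hixy Phi z x y = ixy z x y \<and>
       hiyy Phi z x y = iyy z x y \<and> shiftx Phi z x y = N1 z x y \<and> shifty Phi z x y = N2 z x y \<and>
       lapse_sq Phi z x y = L z x y \<and> omega Phi z x y \<noteq> 0 \<and> iw z x y = 1 / omega Phi z x y"
    using smooth_representatives by blast
  define P where "P = (\<lambda>z x y. rho z x y * (rho z x y * iw z x y * (hxx Phi z x y * (ux z x y + N1 z x y) + hxy Phi z x y * (uy z x y + N2 z x y))))"
  define Q where "Q = (\<lambda>z x y. rho z x y * (rho z x y * iw z x y * (hxy Phi z x y * (ux z x y + N1 z x y) + hyy Phi z x y * (uy z x y + N2 z x y))))"
  define R where "R = (\<lambda>z x y. rho z x y * p z x y)"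
  have s: "smooth3 P" "smooth3 Q" "smooth3 R"
    unfolding P_def Q_def R_def by (intro smooth3_mult smooth3_add sm sg h_smooth)+
  have mom: "rho z x y * momx Phi rho ux uy z x y = P z x y" "rho z x y * momy Phi rho ux uy z x y = Q z x y"
    if "inD x y" for z x y
    using eq[OF G(2)[OF that], of z] by (simp_all add: momx_def momy_def flatx_def flaty_def P_def Q_def)
  define X where "X z = \<lparr>pU1 = P z, pU2 = Q z, pS = rho z, pT = R z\<rparr>" for z
  have "x * P z x y + y * Q z x y = 0" if b: "onbd x y" for z x y
  proof -
    have D: "inD x y" using b by (simp add: onbd_def inD_def)
    have "x * P z x y + y * Q z x y = rho z x y * (x * momx Phi rho ux uy z x y + y * momy Phi rho ux uy z x y)"
      unfolding mom[OF D, symmetric] by (simp add: algebra_simps)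
    then show ?thesis using momentum_normal[OF b, of rho z ux uy] nz[OF D] tan[OF b] by simp
  qed
  then have "smooth_curve X"
    unfolding smooth_curve_def in_pstar_def X_def using s sm by (simp add: smooth2_slice)
  then show ?thesis using that[of X] mom by (simp add: X_def R_def)
qed

end

theorem theorem4:
  fixes Phi :: "(real^3) efun" and rho ux uy p :: "real efun"
  assumes "toroidal Phi" and "boundary_compatible Phi" and "isothermal Phi"
    and "smooth3 rho" and "smooth3 ux" and "smooth3 uy" and "smooth3 p"
    and "\<forall>z x y. inD x y \<longrightarrow> rho z x y \<noteq> 0"
  shows "euler_cond Phi rho ux uy p \<longleftrightarrow>
    (\<exists>X. hamilton (Ham Phi) X \<and>
       (\<forall>z x y. inD x y \<longrightarrow>
          (let s = pS (X z) x y; w = omega Phi z x y;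
               bx = pU1 (X z) x y / s; by = pU2 (X z) x y / s in
           rho z x y = s \<and>
           ux z x y = w / s * sharpx Phi z x y bx by - shiftx Phi z x y \<and>
           uy z x y = w / s * sharpy Phi z x y bx by - shifty Phi z x y \<and>
           p z x y = pT (X z) x y / s)))"
proof -
  interpret isothermal_torus Phi using assms by unfold_locales
  have nz: "rho z x y \<noteq> 0" if "inD x y" for z x y using assms(8) that by blast
  have rel: "(let s = pS (X z) x y; w = omega Phi z x y;
               bx = pU1 (X z) x y / s; by = pU2 (X z) x y / s in
           rho z x y = s \<and>
           ux z x y = w / s * sharpx Phi z x y bx by - shiftx Phi z x y \<and>
           uy z x y = w / s * sharpy Phi z x y bx by - shifty Phi z x y \<and>
           p z x y = pT (X z) x y / s) \<longleftrightarrow>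
      pU1 (X z) x y = rho z x y * momx Phi rho ux uy z x y \<and>
      pU2 (X z) x y = rho z x y * momy Phi rho ux uy z x y \<and> pS (X z) x y = rho z x y \<and>
      pT (X z) x y = rho z x y * p z x y" if D: "inD x y" for X :: "real \<Rightarrow> pel" and z x y
  proof (cases "pS (X z) x y = rho z x y")
    case True
    have "p z x y = pT (X z) x y / rho z x y \<longleftrightarrow> pT (X z) x y = rho z x y * p z x y"
      using nz[OF D, of z] by (auto simp: field_simps)
    then show ?thesis
      unfolding Let_def True
      using velocity_iff_momentum[where rho = rho and z = z and ux = ux and uy = uy and a = "pU1 (X z) x y"
          and b = "pU2 (X z) x y", OF D nz[OF D]] by blast
  qed (auto simp: Let_def)
  show ?thesis
  proof
    assume e: "euler_cond Phi rho ux uy p"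
    then have tan: "x * ux z x y + y * uy z x y = 0" if "onbd x y" for z x y
      using that by (simp add: euler_cond_iff)
    obtain X where X: "smooth_curve X"
      "\<And>z x y. inD x y \<Longrightarrow> pU1 (X z) x y = rho z x y * momx Phi rho ux uy z x y \<and>
        pU2 (X z) x y = rho z x y * momy Phi rho ux uy z x y \<and> pS (X z) x y = rho z x y \<and>
        pT (X z) x y = rho z x y * p z x y"
      using exists_momentum_curve[OF assms(4-7) nz tan] by blast
    have "hamilton (Ham Phi) X"
      using hamilton_iff_euler[OF assms(4-7) nz X tan] e by (simp add: euler_cond_iff)
    then show "\<exists>X. hamilton (Ham Phi) X \<and>
       (\<forall>z x y. inD x y \<longrightarrow>
          (let s = pS (X z) x y; w = omega Phi z x y;
               bx = pU1 (X z) x y / s; by = pU2 (X z) x y / s in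
           rho z x y = s \<and>
           ux z x y = w / s * sharpx Phi z x y bx by - shiftx Phi z x y \<and>
           uy z x y = w / s * sharpy Phi z x y bx by - shifty Phi z x y \<and>
           p z x y = pT (X z) x y / s))"
      using rel X(2) by blast
  next
    assume "\<exists>X. hamilton (Ham Phi) X \<and>
       (\<forall>z x y. inD x y \<longrightarrow>
          (let s = pS (X z) x y; w = omega Phi z x y;
               bx = pU1 (X z) x y / s; by = pU2 (X z) x y / s in
           rho z x y = s \<and>
           ux z x y = w / s * sharpx Phi z x y bx by - shiftx Phi z x y \<and>
           uy z x y = w / s * sharpy Phi z x y bx by - shifty Phi z x y \<and>
           p z x y = pT (X z) x y / s))"
    then obtain X where h: "hamilton (Ham Phi) X" and XD:
      "\<And>z x y. inD x y \<Longrightarrow> pU1 (X z) x y = rho z x y * momx Phi rho ux uy z x y \<and>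
        pU2 (X z) x y = rho z x y * momy Phi rho ux uy z x y \<and> pS (X z) x y = rho z x y \<and>
        pT (X z) x y = rho z x y * p z x y"
      using rel by blast
    have X: "smooth_curve X" using h by (simp add: hamilton_def)
    have tan: "x * ux z x y + y * uy z x y = 0" if b: "onbd x y" for z x y
    proof -
      have D: "inD x y" using b by (simp add: onbd_def inD_def)
      have "x * pU1 (X z) x y + y * pU2 (X z) x y = 0"
        using smooth_curveD(5)[OF X, of z] b by (simp add: in_pstar_def)
      then have "rho z x y * (x * momx Phi rho ux uy z x y + y * momy Phi rho ux uy z x y) = 0"
        using XD[OF D, of z] by (simp add: algebra_simps)
      then show ?thesis using momentum_normal[where rho = rho and z = z, OF b nz[OF D]] nz[OF D, of z] by simp
    qed
    show "euler_cond Phi rho ux uy p"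
      using hamilton_iff_euler[OF assms(4-7) nz X XD tan] h tan by (simp add: euler_cond_iff)
  qed
qed

end
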